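(* Let $R:\mathbb{R}^n\to\mathbb{Z}^n$ be a quantizer, let $L\in\mathbb{R}^{n\times n}$ be nonsingular, and let $T=R\circ L:\mathbb{Z}^n\to\mathbb{Z}^n$. Suppose the matrix $L$ is iteratively nonresonant. Then for any $N\in\mathbb{N}$, the frequency of the $N$-th reachability set $T^N(\mathbb{Z}^n)$ can be computed as $$\mathbf{F}(T^N(\mathbb{Z}^n))=H_N(\{0\})$$ in terms of the functions $H_N:\Pi\to[0,1]$ governed by the linear recurrence equation $$H_N(A)=\sum_{B\in\Pi}\Delta(B\mid A)\,H_{N-1}(B)\qquad\text{for all }A\in\Pi,$$ with the initial condition $H_0=1$ (identically).
   Context: Frequency. For $a\in\mathbb{Z}^n$ and $\ell\in\mathbb{N}^n$ let $P_{a,\ell}=\{x\in\mathbb{Z}^n:\ a_k\le x_k<a_k+\ell_k \text{ for all }1\le k\le n\}$, and for $N\in\mathbb{N}$ let $\mathcal{P}_N=\{P_{a,\ell}:\ a\in\mathbb{Z}^n,\ \ell\in\mathbb{N}^n,\ \min_k\ell_k\ge N\}$. For $A\subset\mathbb{Z}^n$ put $\mathbf{F}_*(A)=\sup_{N\ge1}\inf_{P\in\mathcal{P}_N}\frac{\#(A\cap P)}{\#P}$ and $\mathbf{F}^*(A)=\inf_{N\ge1}\sup_{P\in\mathcal{P}_N}\frac{\#(A\cap P)}{\#P}$. The set $A$ is frequency measurable if $\mathbf{F}_*(A)=\mathbf{F}^*(A)$; the common value is the frequency $\mathbf{F}(A)$. System. A quantizer is a map $R:\mathbb{R}^n\to\mathbb{Z}^n$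 such that $R(u+z)=R(u)+z$ for all $u\in\mathbb{R}^n$, $z\in\mathbb{Z}^n$, and the set $R^{-1}(0)$ is Jordan measurable (bounded with boundary of zero Lebesgue measure). Let $\mu=\int_{R^{-1}(0)}u\,\mathrm{d}u$ and $\widetilde{R}^{-1}(0)=R^{-1}(0)-(I_n+L^{-1})\mu$. Kernel. $\Pi$ is the class of all nonempty finite subsets of $\mathbb{Z}^n$. For finite sets $A,B\subset\mathbb{Z}^n$, $$\Delta(B\mid A)=\mathrm{mes}_n\big\{u\in\widetilde{R}^{-1}(0):\ \mathbb{Z}^n\cap\big(u+L^{-1}(A+R^{-1}(0))\big)=B\big\},$$ where $A+R^{-1}(0)$ is the Minkowski sum and $\mathrm{mes}_n$ the Lebesgue measure. Nonresonance. $\Lambda\in\mathbb{R}^{m\times n}$ is nonresonant if the rows of $\begin{bmatrix}I_n\\ \Lambda\end{bmatrix}$ are linearly independent over the rationals. A nonsingular $L$ is iteratively nonresonant if every finite submatrix (formed from finitely many rows with distinct indices) of the infinite matrix obtained by stacking all nonzero integer powers $L^k$, $k\in\mathbb{Z}\setminus\{0\}$, is nonresonant. *)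

theory Defs
  imports "HOL-Analysis.Analysis"
begin

section \<open>The integer lattice\<close>

text \<open>The lattice is modelled by the type \<open>int ^ 'n\<close>; the embedding into \<open>real ^ 'n\<close> is explicit.\<close>

definition real_vec :: "int ^ 'n \<Rightarrow> real ^ 'n" where
  "real_vec z = (\<chi> i. real_of_int (z $ i))"


section \<open>Frequency\<close>

definition box_lattice :: "int ^ 'n \<Rightarrow> nat ^ 'n \<Rightarrow> (int ^ 'n) set" where
  "box_lattice a l = {x. \<forall>k. a $ k \<le> x $ k \<and> x $ k < a $ k + int (l $ k)}"

definition boxes :: "nat \<Rightarrow> (int ^ 'n) set set" where
  "boxes N = {box_lattice a l | a l. N \<le> Min (range (($) l))}"

definition lower_frequency :: "(int ^ 'n) set \<Rightarrow> real" where
  "lower_frequency A = (SUP N\<in>{1..}. INF P\<in>boxes N. real (card (A \<inter> P)) / real (card P))"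

definition upper_frequency :: "(int ^ 'n) set \<Rightarrow> real" where
  "upper_frequency A = (INF N\<in>{1..}. SUP P\<in>boxes N. real (card (A \<inter> P)) / real (card P))"

definition frequency_measurable :: "(int ^ 'n) set \<Rightarrow> bool" where
  "frequency_measurable A \<longleftrightarrow> lower_frequency A = upper_frequency A"

text \<open>Only meaningful for frequency measurable sets, where it is the common value.\<close>

definition frequency :: "(int ^ 'n) set \<Rightarrow> real" where
  "frequency A = lower_frequency A"


section \<open>Quantized linear systems\<close>

definition jordan_measurable :: "(real ^ 'n) set \<Rightarrow> bool" where
  "jordan_measurable S \<longleftrightarrow> bounded S \<and> frontier S \<in> null_sets lebesgue"

definition quantizer :: "(real ^ 'n \<Rightarrow> int ^ 'n) \<Rightarrow> bool" where
  "quantizer R \<longleftrightarrow> (\<forall>u z. R (u + real_vec z) = R u + z) \<and> jordan_measurable (R -` {0})"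

definition quantized_map :: "(real ^ 'n \<Rightarrow> int ^ 'n) \<Rightarrow> real ^ 'n ^ 'n \<Rightarrow> int ^ 'n \<Rightarrow> int ^ 'n" where
  "quantized_map R L z = R (L *v real_vec z)"

definition cell_mean :: "(real ^ 'n \<Rightarrow> int ^ 'n) \<Rightarrow> real ^ 'n" where
  "cell_mean R = (LINT u:(R -` {0})|lebesgue. u)"

definition shifted_cell :: "(real ^ 'n \<Rightarrow> int ^ 'n) \<Rightarrow> real ^ 'n ^ 'n \<Rightarrow> (real ^ 'n) set" where
  "shifted_cell R L = (\<lambda>u. u - (mat 1 + matrix_inv L) *v cell_mean R) ` (R -` {0})"


section \<open>The transition kernel and the recurrence\<close>

definition finite_lattice_sets :: "(int ^ 'n) set set" where
  "finite_lattice_sets = {A. finite A \<and> A \<noteq> {}}"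

text \<open>In the kernel, \<open>+\<close> between sets is the Minkowski sum.\<close>

definition transition_kernel ::
  "(real ^ 'n \<Rightarrow> int ^ 'n) \<Rightarrow> real ^ 'n ^ 'n \<Rightarrow> (int ^ 'n) set \<Rightarrow> (int ^ 'n) set \<Rightarrow> real" where
  "transition_kernel R L B A = measure lebesgue {u \<in> shifted_cell R L.
     real_vec -` ((\<lambda>v. u + matrix_inv L *v v) ` (real_vec ` A + R -` {0})) = B}"

primrec H_rec :: "(real ^ 'n \<Rightarrow> int ^ 'n) \<Rightarrow> real ^ 'n ^ 'n \<Rightarrow> nat \<Rightarrow> (int ^ 'n) set \<Rightarrow> real" where
  "H_rec R L 0 = (\<lambda>A. 1)"
| "H_rec R L (Suc N) = (\<lambda>A. \<Sum>\<^sub>\<infinity>B\<in>finite_lattice_sets. transition_kernel R L B A * H_rec R L N B)"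


section \<open>Nonresonance\<close>

text \<open>
  A matrix is given as a family of rows over an index set, so that repeated rows count as dependent.
\<close>

definition rationally_independent_rows :: "'j set \<Rightarrow> ('j \<Rightarrow> real ^ 'n) \<Rightarrow> bool" where
  "rationally_independent_rows J r \<longleftrightarrow>
     (\<forall>c :: 'j \<Rightarrow> rat. (\<Sum>j\<in>J. of_rat (c j) *\<^sub>R r j) = 0 \<longrightarrow> (\<forall>j\<in>J. c j = 0))"

definition nonresonant :: "'i set \<Rightarrow> ('i \<Rightarrow> real ^ 'n) \<Rightarrow> bool" where
  "nonresonant I \<Lambda> \<longleftrightarrow>
     rationally_independent_rows (UNIV <+> I) (case_sum (\<lambda>k. row k (mat 1)) \<Lambda>)"

text \<open>The overloaded power on \<open>real ^ 'n ^ 'n\<close> is entrywise, hence the explicit iteration of \<open>**\<close>.\<close>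

definition matrix_powi :: "real ^ 'n ^ 'n \<Rightarrow> int \<Rightarrow> real ^ 'n ^ 'n" where
  "matrix_powi L k =
     (if 0 \<le> k then (((**) L) ^^ nat k) (mat 1) else (((**) (matrix_inv L)) ^^ nat (- k)) (mat 1))"

text \<open>The index \<open>(k, i)\<close> refers to row \<open>i\<close> of the block given by the \<open>k\<close>-th power.\<close>

definition iteratively_nonresonant :: "real ^ 'n ^ 'n \<Rightarrow> bool" where
  "iteratively_nonresonant L \<longleftrightarrow> invertible L \<and>
     (\<forall>I. finite I \<and> I \<subseteq> (UNIV - {0}) \<times> UNIV \<longrightarrow>
        nonresonant I (\<lambda>(k, i). row i (matrix_powi L k)))"

end

theory Submission
  imports Defs
begin

text \<open>
  Follow the preimages of \<open>y\<close> backwards: with \<open>x\<^sub>0 = y\<close>, write \<open>L\<inverse> x\<^sub>k = x\<^sub>k\<^sub>+\<^sub>1 + u\<^sub>k\<^sub>+\<^sub>1\<close> with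
  \<open>u\<^sub>k\<^sub>+\<^sub>1\<close> in the shifted cell. Then \<open>T\<^sup>-\<^sup>k(y) - x\<^sub>k\<close> evolves by
  \<open>A\<^sub>k\<^sub>+\<^sub>1 = \<int>\<^sup>n \<inter> (u\<^sub>k\<^sub>+\<^sub>1 + L\<inverse>(A\<^sub>k + R\<inverse>(0)))\<close>. By induction on \<open>k\<close>, the uniform box mean of
  \<open>1[A\<^sub>k = B] e(\<xi> \<bullet> x\<^sub>k)\<close> is the probability of \<open>B\<close> at time \<open>k\<close> of the Markov chain with kernel \<open>\<Delta>\<close> started
  at \<open>{0}\<close> if \<open>\<xi> = 0\<close>, and vanishes if \<open>\<xi>\<close> is a nontrivial integer combination of rows of negative
  powers of \<open>L\<close>. The start is the equidistribution of characters, which needs only that such \<open>\<xi>\<close> is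
  not integral; in the step, the dependence on \<open>u\<^sub>k\<^sub>+\<^sub>1\<close> is an almost everywhere continuous function of
  \<open>L\<inverse> x\<^sub>k\<close> modulo \<open>\<int>\<^sup>n\<close>, hence a trigonometric polynomial up to an error
  that is small in mean.
\<close>

subsection \<open>Lattice vectors, characters and trigonometric polynomials\<close>

text \<open>The obstacle is independence: the residual \<open>u\<^sub>k\<^sub>+\<^sub>1\<close> and
  the state \<open>A\<^sub>k\<close> are both functions of \<open>y\<close>, and nothing in the
  dynamics separates them. The extra factor e(\<xi> \<bullet> \<open>x\<^sub>k\<close>) in the
  induction does this. Since \<open>x\<^sub>k\<^sub>+\<^sub>1\<close> is L^-1
  \<open>x\<^sub>k\<close> minus \<open>u\<^sub>k\<^sub>+\<^sub>1\<close>, such a factor at time k+1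
  splits into e(\<xi> \<bullet> L^-1 \<open>x\<^sub>k\<close>) and a function of the residual.
  Expanding the latter in integer modes c gives back characters of \<open>x\<^sub>k\<close>, with
  frequency (\<xi> + c) L^-1. The set \<open>frequencies\<close> is generated by exactly this map;
  nonresonance keeps it away from integer vectors, in particular from 0, so only \<xi> = c = 0
  survives, and the constant mode is \<Delta>(B | A). Recentring at \<open>x\<^sub>k\<close> keeps
  the state space finite: the preimage of y moves with y, its recentred version takes finitely many
  values. The empty set is an absorbing state, and for nonempty A the number H_N(A) is the
  probability that the chain started at A has not reached it by time N.\<close>

lemma real_vec_add: "real_vec (a + b) = real_vec a + real_vec b"
  by (simp add: real_vec_def vec_eq_iff)

lemma real_vec_uminus: "real_vec (- a) = - real_vec a"
  by (simp add: real_vec_def vec_eq_iff)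

lemma real_vec_0 [simp]: "real_vec 0 = 0"
  by (simp add: real_vec_def vec_eq_iff)

lemma finite_bounded_real_vec:
  assumes "bounded S"
  shows "finite {z::int^'n. real_vec z \<in> S}"
proof -
  obtain B where B: "\<And>v. v \<in> S \<Longrightarrow> norm v \<le> B"
    using assms by (auto simp: bounded_iff)
  have "{z::int^'n. real_vec z \<in> S} \<subseteq> {z. \<forall>i. z $ i \<in> {-\<lceil>B\<rceil>..\<lceil>B\<rceil>}}"
  proof (clarify)
    fix z :: "int^'n" and i assume "real_vec z \<in> S"
    then have "\<bar>real_vec z $ i\<bar> \<le> B"
      using B component_le_norm_cart order_trans by blast
    then have "\<bar>real_of_int (z $ i)\<bar> \<le> B"
      by (simp add: real_vec_def)
    then show "z $ i \<in> {-\<lceil>B\<rceil>..\<lceil>B\<rceil>}"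
      by simp linarith
  qed
  moreover have "finite {z::int^'n. \<forall>i. z $ i \<in> {-\<lceil>B\<rceil>..\<lceil>B\<rceil>}}"
  proof -
    have "finite (PiE (UNIV :: 'n set) (\<lambda>_. {-\<lceil>B\<rceil>..\<lceil>B\<rceil>}))"
      by (intro finite_PiE) auto
    then have "finite (vec_lambda ` PiE (UNIV :: 'n set) (\<lambda>_. {-\<lceil>B\<rceil>..\<lceil>B\<rceil>}))"
      by blast
    moreover have "{z::int^'n. \<forall>i. z $ i \<in> {-\<lceil>B\<rceil>..\<lceil>B\<rceil>}}
        \<subseteq> vec_lambda ` PiE (UNIV :: 'n set) (\<lambda>_. {-\<lceil>B\<rceil>..\<lceil>B\<rceil>})"
    proof (clarify)
      fix z :: "int^'n" assume "\<forall>i. z $ i \<in> {-\<lceil>B\<rceil>..\<lceil>B\<rceil>}"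
      then show "z \<in> vec_lambda ` PiE (UNIV :: 'n set) (\<lambda>_. {-\<lceil>B\<rceil>..\<lceil>B\<rceil>})"
        by (intro image_eqI[of _ _ "vec_nth z"]) auto
    qed
    ultimately show ?thesis
      using finite_subset by blast
  qed
  ultimately show ?thesis
    using finite_subset by blast
qed

definition character :: "real ^ 'n \<Rightarrow> real ^ 'n \<Rightarrow> complex" where
  "character \<xi> v = cis (2 * pi * (\<xi> \<bullet> v))"

lemma norm_character [simp]: "norm (character \<xi> v) = 1"
  by (simp add: character_def)

lemma character_0 [simp]: "character 0 v = 1" "character \<xi> 0 = 1"
  by (simp_all add: character_def)

lemma character_add_left: "character (\<xi> + \<psi>) v = character \<xi> v * character \<psi> v"
  by (simp add: character_def cis_mult inner_add_left algebra_simps)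

lemma character_add_right: "character \<xi> (u + v) = character \<xi> u * character \<xi> v"
  by (simp add: character_def cis_mult inner_add_right algebra_simps)

lemma character_matrix_vector: "character \<xi> (M *v v) = character (\<xi> v* M) v"
  by (simp add: character_def dot_lmul_matrix)

lemma character_real_vec [simp]: "character (real_vec c) (real_vec z) = 1"
proof -
  have "real_vec c \<bullet> real_vec z = real_of_int (\<Sum>i\<in>UNIV. c $ i * z $ i)"
    by (simp add: inner_vec_def real_vec_def)
  then show ?thesis
    by (metis Ints_of_int character_def cis_multiple_2pi)
qed

lemma continuous_on_character: "continuous_on S (character \<xi>)"
  unfolding character_def cis_conv_exp by (intro continuous_intros)

text \<open>Only integer frequencies occur, so every member is periodic under the lattice. The
  inductive form reduces statements that are linear in the function to single characters.\<close>

inductive_set trig_poly :: "(real ^ 'n \<Rightarrow> complex) set" where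
  trig_poly_character: "character (real_vec c) \<in> trig_poly"
| trig_poly_add: "f \<in> trig_poly \<Longrightarrow> g \<in> trig_poly \<Longrightarrow> (\<lambda>v. f v + g v) \<in> trig_poly"
| trig_poly_scale: "f \<in> trig_poly \<Longrightarrow> (\<lambda>v. a * f v) \<in> trig_poly"

lemma trig_poly_const: "(\<lambda>v. a) \<in> trig_poly"
  using trig_poly_scale[OF trig_poly_character[of 0], of a] by simp

lemma trig_poly_diff: "f \<in> trig_poly \<Longrightarrow> g \<in> trig_poly \<Longrightarrow> (\<lambda>v. f v - g v) \<in> trig_poly"
  using trig_poly_add[of f "\<lambda>v. (-1) * g v"] trig_poly_scale[of g "-1"] by simp

lemma trig_poly_mult:
  assumes "f \<in> trig_poly" and g: "g \<in> trig_poly"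
  shows "(\<lambda>v. f v * g v) \<in> trig_poly"
  using assms(1)
proof induction
  case (trig_poly_character c)
  show ?case using g
  proof induction
    case (trig_poly_character d)
    have "(\<lambda>v. character (real_vec c) v * character (real_vec d) v) = character (real_vec (c + d))"
      by (simp add: fun_eq_iff real_vec_add character_add_left)
    then show ?case using trig_poly.trig_poly_character by simp
  next
    case (trig_poly_add f g)
    from trig_poly.trig_poly_add[OF trig_poly_add.IH] show ?case by (simp add: algebra_simps)
  next
    case (trig_poly_scale f a)
    from trig_poly.trig_poly_scale[OF trig_poly_scale.IH, of a] show ?case by (simp add: algebra_simps)
  qed
next
  case (trig_poly_add f g)
  from trig_poly.trig_poly_add[OF trig_poly_add.IH] show ?case by (simp add: algebra_simps)
next
  case (trig_poly_scale f a)
  from trig_poly.trig_poly_scale[OF trig_poly_scale.IH, of a] show ?case by (simp add: algebra_simps)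
qed

lemma continuous_on_trig_poly: "f \<in> trig_poly \<Longrightarrow> continuous_on S f"
  by (induction rule: trig_poly.induct) (intro continuous_intros continuous_on_character | assumption)+

lemma bounded_trig_poly: "f \<in> trig_poly \<Longrightarrow> \<exists>b. \<forall>v. norm (f v) \<le> b"
proof (induction rule: trig_poly.induct)
  case (trig_poly_character c)
  then show ?case by auto
next
  case (trig_poly_add f g)
  then show ?case by (meson add_mono norm_triangle_le)
next
  case (trig_poly_scale f a)
  then obtain b where "\<forall>v. norm (f v) \<le> b" by blast
  then have "\<forall>v. norm (a * f v) \<le> norm a * b"
    by (simp add: norm_mult mult_left_mono)
  then show ?case by blast
qed


subsection \<open>The torus and Lipschitz envelopes\<close>

text \<open>The covering map onto the torus of \<real>^n modulo \<int>^n, realised in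
  \<open>complex ^ 'n\<close> so that its image is a compact metric space.\<close>

definition torus_point :: "real ^ 'n \<Rightarrow> complex ^ 'n" where
  "torus_point v = (\<chi> i. cis (2 * pi * v $ i))"

definition torus :: "(complex ^ 'n) set" where
  "torus = {z. \<forall>i. norm (z $ i) = 1}"

lemma torus_point_in_torus [simp]: "torus_point v \<in> torus"
  by (simp add: torus_point_def torus_def)

lemma continuous_on_torus_point: "continuous_on S torus_point"
  unfolding torus_point_def cis_conv_exp by (intro continuous_intros)

lemma compact_torus: "compact torus"
proof (rule compact_eq_bounded_closed[THEN iffD2], intro conjI)
  show "bounded (torus :: (complex^'n) set)"
    unfolding bounded_iff
  proof (intro exI ballI)
    fix z :: "complex^'n" assume "z \<in> torus"
    then have "norm z \<le> (\<Sum>i\<in>UNIV. norm (z $ i))"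
      by (simp add: norm_le_l1_cart norm_vec_def L2_set_le_sum)
    also have "\<dots> = CARD('n)"
      using \<open>z \<in> torus\<close> by (simp add: torus_def)
    finally show "norm z \<le> CARD('n)" .
  qed
  have "closed {z::complex^'n. norm (z $ i) = 1}" for i
    by (intro closed_Collect_eq continuous_intros)
  then show "closed (torus :: (complex^'n) set)"
    unfolding torus_def by (rule closed_Collect_all)
qed

text \<open>Dividing by the second value moves the comparison to the point 1, where
  \<open>Arg\<close> is continuous; hence one \<eta> serves all pairs.\<close>

lemma cis_close:
  assumes "\<delta> > 0"
  obtains \<eta> where "\<eta> > 0"
    "\<And>a b. dist (cis (2 * pi * a)) (cis (2 * pi * b)) < \<eta> \<Longrightarrow> \<exists>m::int. \<bar>a - of_int m - b\<bar> < \<delta>"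
proof -
  have "isCont Arg 1" by (rule continuous_at_Arg) auto
  then obtain \<eta> where "\<eta> > 0" and \<eta>: "\<And>z. dist z 1 < \<eta> \<Longrightarrow> dist (Arg z) (Arg 1) < 2 * pi * \<delta>"
    unfolding continuous_at_eps_delta using assms by (metis mult_pos_pos pi_gt_zero zero_less_numeral)
  have "\<exists>m::int. \<bar>a - of_int m - b\<bar> < \<delta>" if "dist (cis (2 * pi * a)) (cis (2 * pi * b)) < \<eta>" for a b
  proof -
    let ?z = "cis (2 * pi * (a - b))"
    have "?z - 1 = (cis (2 * pi * a) - cis (2 * pi * b)) * cis (- (2 * pi * b))"
      by (simp add: algebra_simps cis_mult)
    then have "dist ?z 1 < \<eta>"
      using that by (simp add: dist_norm norm_mult)
    then have *: "\<bar>Arg ?z\<bar> < 2 * pi * \<delta>"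
      using \<eta> by (fastforce simp: dist_norm)
    have "cis (Arg ?z) = ?z"
      by (simp add: cis_Arg sgn_div_norm)
    then obtain m :: int where "2 * pi * (a - b) = Arg ?z + 2 * pi * m"
      by (metis cis.sel sin_cos_eq_iff)
    then have "2 * pi * (a - of_int m - b) = Arg ?z"
      by (simp add: algebra_simps)
    with * have "\<bar>2 * pi * (a - of_int m - b)\<bar> < 2 * pi * \<delta>" by metis
    then show ?thesis
      by (auto simp: abs_mult)
  qed
  with \<open>\<eta> > 0\<close> show thesis using that by blast
qed

lemma torus_point_close:
  assumes "\<delta> > 0"
  obtains \<eta> where "\<eta> > 0"
    "\<And>t v :: real^'n. dist (torus_point t) (torus_point v) < \<eta> \<Longrightarrow> \<exists>z. dist (t - real_vec z) v < \<delta>"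
proof -
  \<comment> \<open>The Euclidean norm is bounded below by the sum of the coordinate errors, so each
    coordinate gets an equal share of \<delta>.\<close>
  have "\<delta> / CARD('n) > 0" using assms by simp
  from cis_close[OF this] obtain \<eta> where "\<eta> > 0" and \<eta>:
    "\<And>a b. dist (cis (2 * pi * a)) (cis (2 * pi * b)) < \<eta> \<Longrightarrow> \<exists>m::int. \<bar>a - of_int m - b\<bar> < \<delta> / CARD('n)"
    by blast
  have "\<exists>z. dist (t - real_vec z) v < \<delta>" if "dist (torus_point t) (torus_point v) < \<eta>" for t v :: "real^'n"
  proof -
    have "dist (cis (2 * pi * t $ i)) (cis (2 * pi * v $ i)) < \<eta>" for i
      using le_less_trans[OF dist_vec_nth_le that, of i] by (simp add: torus_point_def)
    then have "\<forall>i. \<exists>m::int. \<bar>t $ i - of_int m - v $ i\<bar> < \<delta> / CARD('n)"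
      using \<eta> by blast
    then obtain m :: "'n \<Rightarrow> int" where m: "\<And>i. \<bar>t $ i - of_int (m i) - v $ i\<bar> < \<delta> / CARD('n)"
      by metis
    have "norm (t - real_vec (\<chi> i. m i) - v) \<le> (\<Sum>i\<in>UNIV. \<bar>(t - real_vec (\<chi> i. m i) - v) $ i\<bar>)"
      by (rule norm_le_l1_cart)
    also have "\<dots> < (\<Sum>i\<in>(UNIV::'n set). \<delta> / CARD('n))"
      using m by (intro sum_strict_mono) (auto simp: real_vec_def)
    finally show ?thesis by (auto simp: dist_norm)
  qed
  with \<open>\<eta> > 0\<close> show thesis using that by blast
qed

text \<open>Sup-convolution with a cone of slope \<open>k\<close>: for bounded \<open>w\<close>, the
  smallest \<open>k\<close>-Lipschitz function on \<open>complex ^ 'n\<close> whose pullback along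
  \<open>torus_point\<close> dominates \<open>w\<close>.\<close>

definition upper_envelope :: "(real ^ 'n \<Rightarrow> real) \<Rightarrow> nat \<Rightarrow> complex ^ 'n \<Rightarrow> real" where
  "upper_envelope w k z = (SUP t. w t - k * dist z (torus_point t))"

context
  fixes w :: "real ^ 'n \<Rightarrow> real" and M :: real
  assumes bound: "\<And>v. \<bar>w v\<bar> \<le> M"
begin

lemma upper_envelope_bdd: "bdd_above (range (\<lambda>t. w t - real k * dist z (torus_point t)))"
proof (rule bdd_aboveI2)
  fix t show "w t - real k * dist z (torus_point t) \<le> M"
    using bound[of t] by (simp add: abs_le_iff) (smt (verit) mult_nonneg_nonneg of_nat_0_le_iff zero_le_dist)
qed

lemma upper_envelope_ge: "w v \<le> upper_envelope w k (torus_point v)"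
  unfolding upper_envelope_def by (rule cSUP_upper2[OF upper_envelope_bdd, of v]) auto

lemma upper_envelope_le: "upper_envelope w k z \<le> M"
  unfolding upper_envelope_def
proof (rule cSUP_least)
  fix t show "w t - real k * dist z (torus_point t) \<le> M"
    using bound[of t] by (simp add: abs_le_iff) (smt (verit) mult_nonneg_nonneg of_nat_0_le_iff zero_le_dist)
qed auto

lemma upper_envelope_lipschitz: "upper_envelope w k z \<le> upper_envelope w k z' + k * dist z z'"
  unfolding upper_envelope_def
proof (rule cSUP_least)
  fix t
  have "w t - real k * dist z (torus_point t)
      \<le> w t - real k * dist z' (torus_point t) + real k * dist z z'"
    using mult_left_mono[OF dist_triangle2[of z' "torus_point t" z], of "real k"]
    by (simp add: algebra_simps dist_commute)
  also have "w t - real k * dist z' (torus_point t) \<le> (SUP t. w t - real k * dist z' (torus_point t))"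
    by (rule cSUP_upper[OF _ upper_envelope_bdd]) auto
  finally show "w t - real k * dist z (torus_point t)
      \<le> (SUP t. w t - real k * dist z' (torus_point t)) + real k * dist z z'" by simp
qed auto

lemma continuous_on_upper_envelope: "continuous_on S (upper_envelope w k)"
proof -
  have "\<bar>upper_envelope w k z - upper_envelope w k z'\<bar> \<le> k * dist z z'" for z z'
    using upper_envelope_lipschitz[of k z z'] upper_envelope_lipschitz[of k z' z]
    by (simp add: abs_le_iff dist_commute)
  then have "(real k)-lipschitz_on S (upper_envelope w k)"
    by (intro lipschitz_onI) (auto simp: dist_norm)
  then show ?thesis by (rule lipschitz_on_continuous_on)
qed

text \<open>Points whose torus image is near that of \<open>v\<close> are near \<open>v\<close>
  modulo the lattice, so continuity and periodicity control \<open>w\<close> there. At all other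
  points the penalty wins for large \<open>k\<close>.\<close>

lemma upper_envelope_tendsto:
  assumes periodic: "\<And>v z. w (v + real_vec z) = w v" and cont: "isCont w v"
  shows "(\<lambda>k. upper_envelope w k (torus_point v)) \<longlonglongrightarrow> w v"
proof (rule LIMSEQ_I)
  fix e :: real assume "e > 0"
  then obtain \<delta> where "\<delta> > 0" and \<delta>: "\<And>t. dist t v < \<delta> \<Longrightarrow> dist (w t) (w v) < e / 2"
    using cont unfolding continuous_at_eps_delta by (metis half_gt_zero)
  from torus_point_close[OF \<open>\<delta> > 0\<close>] obtain \<eta> where "\<eta> > 0" and \<eta>:
    "\<And>t v :: real^'n. dist (torus_point t) (torus_point v) < \<eta> \<Longrightarrow> \<exists>z. dist (t - real_vec z) v < \<delta>"
    by blast
  \<comment> \<open>From slope \<open>K\<close> on, the penalty at distance \<eta> exceeds 2M, the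
    largest possible oscillation of \<open>w\<close>.\<close>
  obtain K :: nat where K: "2 * M / \<eta> < K" using reals_Archimedean2 by blast
  have "norm (upper_envelope w k (torus_point v) - w v) < e" if "k \<ge> K" for k
  proof -
    have "upper_envelope w k (torus_point v) \<le> w v + e / 2"
      unfolding upper_envelope_def
    proof (rule cSUP_least)
      fix t
      show "w t - real k * dist (torus_point v) (torus_point t) \<le> w v + e / 2"
      proof (cases "dist (torus_point t) (torus_point v) < \<eta>")
        case True
        then obtain z where "dist (t - real_vec z) v < \<delta>" using \<eta> by blast
        then have "dist (w (t - real_vec z)) (w v) < e / 2" by (rule \<delta>)
        moreover have "w (t - real_vec z) = w t"
          using periodic[of "t - real_vec z" z] by simp
        ultimately have "\<bar>w t - w v\<bar> < e / 2" by (simp only: dist_real_def)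
        then have "w t \<le> w v + e / 2" by linarith
        then show ?thesis
          by (smt (verit) mult_nonneg_nonneg of_nat_0_le_iff zero_le_dist)
      next
        case False
        have "2 * M \<le> real K * \<eta>" using K \<open>\<eta> > 0\<close> by (simp add: field_simps)
        also have "\<dots> \<le> real k * dist (torus_point v) (torus_point t)"
          using False that \<open>\<eta> > 0\<close> by (intro mult_mono) (auto simp: dist_commute)
        finally show ?thesis using bound[of t] bound[of v] \<open>e > 0\<close> by linarith
      qed
    qed auto
    with upper_envelope_ge[of v k] \<open>e > 0\<close> show ?thesis by simp
  qed
  then show "\<exists>K. \<forall>k\<ge>K. norm (upper_envelope w k (torus_point v) - w v) < e" by blast
qed

end

text \<open>Stone--Weierstrass is applied on the torus, since trigonometric polynomials do not separate the
  boundary points of a closed cube.\<close>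

lemma trig_poly_dense:
  fixes \<phi> :: "complex ^ 'n \<Rightarrow> real"
  assumes "continuous_on torus \<phi>" "e > 0"
  obtains g :: "real ^ 'n \<Rightarrow> real" where "(\<lambda>v. complex_of_real (g v)) \<in> trig_poly"
    "\<And>v. \<bar>\<phi> (torus_point v) - g v\<bar> < e"
proof -
  \<comment> \<open>A real algebra is required: it consists of real functions whose pullback, viewed
    as complex, is a trigonometric polynomial. Real and imaginary parts of the coordinates lie in it
    and separate points.\<close>
  define P :: "(complex ^ 'n \<Rightarrow> real) \<Rightarrow> bool" where
    "P f \<longleftrightarrow> continuous_on torus f \<and> (\<lambda>v. complex_of_real (f (torus_point v))) \<in> trig_poly" for f
  have char: "(\<lambda>v. cis (2 * pi * v $ i)) \<in> trig_poly" "(\<lambda>v. cis (- 2 * pi * v $ i)) \<in> trig_poly" for i :: 'n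
  proof -
    have *: "real_vec (axis i m) \<bullet> v = of_int m * v $ i" for v and m :: int
    proof -
      have "real_vec (axis i m) = axis i (of_int m)"
        by (simp add: vec_eq_iff real_vec_def axis_def)
      then show ?thesis by (simp add: inner_axis')
    qed
    have "character (real_vec (axis i 1)) = (\<lambda>v. cis (2 * pi * v $ i))"
      by (simp add: fun_eq_iff character_def *)
    then show "(\<lambda>v. cis (2 * pi * v $ i)) \<in> trig_poly"
      using trig_poly_character by metis
    have "character (real_vec (axis i (-1))) = (\<lambda>v. cis (- 2 * pi * v $ i))"
      by (simp add: fun_eq_iff character_def *)
    then show "(\<lambda>v. cis (- 2 * pi * v $ i)) \<in> trig_poly"
      using trig_poly_character by metis
  qed
  have cnj: "(\<lambda>v. cnj (cis (2 * pi * v $ i))) \<in> trig_poly" for i :: 'n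
    using char(2)[of i] by (simp add: cis_cnj)
  have re: "P (\<lambda>z. Re (z $ i))" for i
  proof -
    have "(\<lambda>v. (1/2) * (cis (2 * pi * v $ i) + cnj (cis (2 * pi * v $ i)))) \<in> trig_poly"
      by (intro trig_poly_scale trig_poly_add char cnj)
    moreover have "(1/2) * (z + cnj z) = complex_of_real (Re z)" for z
      by (simp add: complex_eq_iff)
    ultimately show ?thesis
      unfolding P_def torus_point_def by (auto intro!: continuous_intros simp del: cis.sel)
  qed
  have im: "P (\<lambda>z. Im (z $ i))" for i
  proof -
    have "(\<lambda>v. (- \<i>/2) * (cis (2 * pi * v $ i) - cnj (cis (2 * pi * v $ i)))) \<in> trig_poly"
      by (intro trig_poly_scale trig_poly_diff char cnj)
    moreover have "(- \<i>/2) * (z - cnj z) = complex_of_real (Im z)" for z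
      by (simp add: complex_eq_iff)
    ultimately show ?thesis
      unfolding P_def torus_point_def by (auto intro!: continuous_intros simp del: cis.sel)
  qed
  have "\<exists>g. P g \<and> (\<forall>z\<in>torus. \<bar>\<phi> z - g z\<bar> < e)"
  proof (rule Stone_Weierstrass_HOL[OF compact_torus])
    show "P (\<lambda>x. c)" for c unfolding P_def by (simp add: trig_poly_const)
    show "P (\<lambda>x. f x + g x)" if "P f \<and> P g" for f g
      using that unfolding P_def by (auto intro!: continuous_intros trig_poly_add)
    show "P (\<lambda>x. f x * g x)" if "P f \<and> P g" for f g
      using that unfolding P_def by (auto intro!: continuous_intros trig_poly_mult)
    show "\<exists>f. P f \<and> f x \<noteq> f y" if "x \<in> torus \<and> y \<in> torus \<and> x \<noteq> y" for x y
    proof -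
      obtain i where "x $ i \<noteq> y $ i" using \<open>_ \<and> _ \<and> x \<noteq> y\<close> by (auto simp: vec_eq_iff)
      then have "Re (x $ i) \<noteq> Re (y $ i) \<or> Im (x $ i) \<noteq> Im (y $ i)" by (simp add: complex_eq_iff)
      then show ?thesis using re[of i] im[of i] by auto
    qed
  qed (use assms in \<open>auto simp: P_def\<close>)
  then obtain g where "P g" "\<forall>z\<in>torus. \<bar>\<phi> z - g z\<bar> < e" by blast
  then show thesis using that[of "\<lambda>v. g (torus_point v)"] by (simp add: P_def)
qed


subsection \<open>Fundamental domains\<close>

definition fundamental_domain :: "(real ^ 'n) set \<Rightarrow> bool" where
  "fundamental_domain D \<longleftrightarrow> D \<in> sets lebesgue \<and> bounded D \<and> (\<forall>v. \<exists>!z. v - real_vec z \<in> D)"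

lemma lebesgue_distr_translation:
  "distr lebesgue lebesgue ((+) t) = (lebesgue :: 'a::euclidean_space measure)"
  "(+) t \<in> lebesgue \<rightarrow>\<^sub>M (lebesgue :: 'a::euclidean_space measure)"
proof -
  have *: "(\<lambda>x::'a. t + (\<Sum>j\<in>Basis. (1 * (x \<bullet> j)) *\<^sub>R j)) = (+) t"
    by (simp add: fun_eq_iff euclidean_representation)
  have "lebesgue = density (distr lebesgue lebesgue ((+) t)) (\<lambda>_. \<Prod>j\<in>(Basis::'a set). \<bar>1::real\<bar>)"
    using lebesgue_affine_euclidean[of "\<lambda>_. 1" t] unfolding * by simp
  then show "distr lebesgue lebesgue ((+) t) = (lebesgue :: 'a measure)"
    by (simp add: density_1)
  show "(+) t \<in> lebesgue \<rightarrow>\<^sub>M (lebesgue :: 'a measure)"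
    using lebesgue_affine_measurable[of "\<lambda>_. 1" t] unfolding * by simp
qed

lemma integral_lebesgue_translation:
  fixes f :: "'a::euclidean_space \<Rightarrow> 'b::{banach, second_countable_topology}"
  assumes "f \<in> borel_measurable lebesgue"
  shows "(LINT v|lebesgue. f (t + v)) = (LINT v|lebesgue. f v)"
  using integral_distr[OF lebesgue_distr_translation(2)[of t] assms]
  by (simp add: lebesgue_distr_translation(1))

lemma integrable_indicator_bounded:
  fixes f :: "real^'n \<Rightarrow> 'b::{banach, second_countable_topology}"
  assumes "D \<in> sets lebesgue" "bounded D" "f \<in> borel_measurable lebesgue" "\<And>v. norm (f v) \<le> b"
  shows "set_integrable lebesgue D f"
  unfolding set_integrable_def
proof (rule integrableI_bounded_set_indicator)
  show "emeasure lebesgue D < \<infinity>"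
    using fmeasurableD2[OF bounded_set_imp_lmeasurable[OF assms(2,1)]] by (simp add: less_top)
qed (use assms in auto)

text \<open>The integer translates of \<open>E\<close> cut \<open>D\<close> into pieces; moving each
  piece back by its lattice vector reassembles \<open>E\<close>, and a periodic integrand does not
  notice.\<close>

lemma fundamental_domain_exchange:
  fixes f :: "real^'n \<Rightarrow> 'b::{banach, second_countable_topology}"
  assumes D: "fundamental_domain D" "fundamental_domain E"
    and f: "f \<in> borel_measurable lebesgue" "\<And>v. norm (f v) \<le> b"
    and periodic: "\<And>v z. f (v + real_vec z) = f v"
  shows "(LINT v:D|lebesgue. f v) = (LINT v:E|lebesgue. f v)"
proof -
  \<comment> \<open>The lattice vectors z for which \<open>D\<close> meets \<open>E\<close> + z.
    Boundedness makes them finitely many, so the decomposition is a finite sum of integrals.\<close>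
  define Z where "Z = {z. real_vec z \<in> (\<lambda>(x, y). x - y) ` (D \<times> E)}"
  have [measurable]: "D \<in> sets lebesgue" "E \<in> sets lebesgue" "f \<in> borel_measurable lebesgue"
    and "bounded D" "bounded E"
    using assms by (auto simp: fundamental_domain_def)
  have "finite Z"
    unfolding Z_def by (rule finite_bounded_real_vec bounded_minus \<open>bounded D\<close> \<open>bounded E\<close>)+
  define g where "g z v = (indicator D v * indicator E (v - real_vec z) :: real) *\<^sub>R f v" for z v
  define g' where "g' z v = (indicator D (v + real_vec z) * indicator E v :: real) *\<^sub>R f v" for z v
  have shift: "(\<lambda>v. v + real_vec z) \<in> lebesgue \<rightarrow>\<^sub>M lebesgue" for z :: "int^'n"
    using lebesgue_distr_translation(2)[of "real_vec z"] by (simp add: add.commute[of _ "real_vec z"])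
  have shift': "(\<lambda>v. v - real_vec z) \<in> lebesgue \<rightarrow>\<^sub>M lebesgue" for z :: "int^'n"
    using shift[of "-z"] by (simp add: real_vec_uminus)
  have g: "g z \<in> borel_measurable lebesgue" for z
  proof -
    have "(\<lambda>v. indicator E (v - real_vec z) :: real) \<in> borel_measurable lebesgue"
      by (rule measurable_compose[OF shift', of "indicator E"]) measurable
    then show ?thesis unfolding g_def by measurable
  qed
  have g': "g' z \<in> borel_measurable lebesgue" for z
  proof -
    have "(\<lambda>v. indicator D (v + real_vec z) :: real) \<in> borel_measurable lebesgue"
      by (rule measurable_compose[OF shift, of "indicator D"]) measurable
    then show ?thesis unfolding g'_def by measurable
  qed
  have gi: "integrable lebesgue (g z)" for z
  proof (rule Bochner_Integration.integrable_bound)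
    show "integrable lebesgue (\<lambda>v. indicator D v *\<^sub>R f v)"
      using integrable_indicator_bounded[OF _ \<open>bounded D\<close> f] by (simp add: set_integrable_def)
    show "AE v in lebesgue. norm (g z v) \<le> norm (indicator D v *\<^sub>R f v)"
      by (auto simp: g_def indicator_def)
  qed (rule g)
  have gi': "integrable lebesgue (g' z)" for z
  proof (rule Bochner_Integration.integrable_bound)
    show "integrable lebesgue (\<lambda>v. indicator E v *\<^sub>R f v)"
      using integrable_indicator_bounded[OF _ \<open>bounded E\<close> f] by (simp add: set_integrable_def)
    show "AE v in lebesgue. norm (g' z v) \<le> norm (indicator E v *\<^sub>R f v)"
      by (auto simp: g'_def indicator_def)
  qed (rule g')
  have one: "(\<Sum>z\<in>Z. g z v) = indicator D v *\<^sub>R f v" for v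
  proof (cases "v \<in> D")
    case True
    obtain z0 where z0: "v - real_vec z0 \<in> E" "\<And>z. v - real_vec z \<in> E \<Longrightarrow> z = z0"
      using D(2) unfolding fundamental_domain_def by metis
    have "real_vec z0 = v - (v - real_vec z0)" by simp
    then have "z0 \<in> Z" unfolding Z_def using True z0(1) by (auto intro!: image_eqI[of _ _ "(v, v - real_vec z0)"])
    have "(\<Sum>z\<in>Z. g z v) = (\<Sum>z\<in>{z0}. g z v)"
      using \<open>z0 \<in> Z\<close> \<open>finite Z\<close> z0(2) by (intro sum.mono_neutral_right) (auto simp: g_def indicator_def)
    then show ?thesis using True z0(1) by (simp add: g_def)
  qed (simp add: g_def)
  have two: "(\<Sum>z\<in>Z. g' z v) = indicator E v *\<^sub>R f v" for v
  proof (cases "v \<in> E")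
    case True
    obtain z1 where z1: "v - real_vec z1 \<in> D" "\<And>z. v - real_vec z \<in> D \<Longrightarrow> z = z1"
      using D(1) unfolding fundamental_domain_def by metis
    have *: "v + real_vec z \<in> D \<longleftrightarrow> z = - z1" for z
      using z1(1) z1(2)[of "-z"] by (auto simp: real_vec_uminus)
    have "real_vec (- z1) = (v + real_vec (- z1)) - v" by simp
    then have "- z1 \<in> Z" unfolding Z_def using True * by (auto intro!: image_eqI[of _ _ "(v + real_vec (- z1), v)"])
    have "(\<Sum>z\<in>Z. g' z v) = (\<Sum>z\<in>{- z1}. g' z v)"
      using \<open>- z1 \<in> Z\<close> \<open>finite Z\<close> * by (intro sum.mono_neutral_right) (auto simp: g'_def indicator_def)
    then show ?thesis using True * by (simp add: g'_def)
  qed (simp add: g'_def)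
  have "(LINT v:D|lebesgue. f v) = (\<Sum>z\<in>Z. LINT v|lebesgue. g z v)"
    unfolding set_lebesgue_integral_def one[symmetric] using gi by (rule Bochner_Integration.integral_sum)
  also have "\<dots> = (\<Sum>z\<in>Z. LINT v|lebesgue. g z (real_vec z + v))"
    by (simp add: integral_lebesgue_translation[OF g])
  also have "\<dots> = (\<Sum>z\<in>Z. LINT v|lebesgue. g' z v)"
    by (simp add: g_def g'_def add.commute[of "real_vec _"] periodic)
  also have "\<dots> = (LINT v:E|lebesgue. f v)"
    unfolding set_lebesgue_integral_def two[symmetric]
    using gi' by (rule Bochner_Integration.integral_sum[symmetric])
  finally show ?thesis .
qed

lemma fundamental_domain_translation:
  assumes "fundamental_domain D"
  shows "fundamental_domain ((+) t ` D)"
proof -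
  have "v - real_vec z \<in> (+) t ` D \<longleftrightarrow> (v - t) - real_vec z \<in> D" for v z
  proof
    assume "v - real_vec z \<in> (+) t ` D"
    then obtain d where "d \<in> D" "v - real_vec z = t + d" by blast
    then have "(v - t) - real_vec z = d" by (simp add: algebra_simps)
    with \<open>d \<in> D\<close> show "(v - t) - real_vec z \<in> D" by simp
  next
    assume "(v - t) - real_vec z \<in> D"
    moreover have "v - real_vec z = t + ((v - t) - real_vec z)" by simp
    ultimately show "v - real_vec z \<in> (+) t ` D" by blast
  qed
  then show ?thesis
    using assms lebesgue_sets_translation[of D t] bounded_translation[of D t]
    by (auto simp: fundamental_domain_def)
qed

lemma fundamental_domain_unit_cube: "fundamental_domain {v::real^'n. \<forall>i. 0 \<le> v $ i \<and> v $ i < 1}"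
  unfolding fundamental_domain_def
proof (intro conjI allI)
  show "{v::real^'n. \<forall>i. 0 \<le> v $ i \<and> v $ i < 1} \<in> sets lebesgue"
    by (rule sets_completionI_sets) measurable
  show "bounded {v::real^'n. \<forall>i. 0 \<le> v $ i \<and> v $ i < 1}"
    by (rule bounded_subset[OF bounded_cbox[of 0 "1::real^'n"]]) (auto simp: mem_box_cart less_imp_le)
  fix v :: "real^'n"
  show "\<exists>!z. v - real_vec z \<in> {v. \<forall>i. 0 \<le> v $ i \<and> v $ i < 1}"
  proof (rule ex1I[of _ "\<chi> i. \<lfloor>v $ i\<rfloor>"])
    show "v - real_vec (\<chi> i. \<lfloor>v $ i\<rfloor>) \<in> {v. \<forall>i. 0 \<le> v $ i \<and> v $ i < 1}"
      by (simp add: real_vec_def) linarith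
    fix z assume z: "v - real_vec z \<in> {v. \<forall>i. 0 \<le> v $ i \<and> v $ i < 1}"
    have "z $ i = \<lfloor>v $ i\<rfloor>" for i
    proof (rule floor_unique[symmetric])
      show "real_of_int (z $ i) \<le> v $ i" "v $ i < real_of_int (z $ i) + 1"
        using z by (auto simp: real_vec_def algebra_simps dest!: spec[of _ i])
    qed
    then show "z = (\<chi> i. \<lfloor>v $ i\<rfloor>)" by (simp add: vec_eq_iff)
  qed
qed

text \<open>Exchange with the half-open unit cube for the constant 1; the measure of that cube is
  squeezed between those of the open and the closed cube.\<close>

lemma measure_fundamental_domain:
  fixes D :: "(real^'n) set"
  assumes "fundamental_domain D"
  shows "measure lebesgue D = 1"
proof -
  let ?Q = "{v::real^'n. \<forall>i. 0 \<le> v $ i \<and> v $ i < 1}"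
  have Q: "?Q \<in> sets lebesgue" "D \<in> sets lebesgue"
    using fundamental_domain_unit_cube assms by (auto simp: fundamental_domain_def)
  have sub: "box 0 1 \<subseteq> ?Q" "?Q \<subseteq> cbox 0 1" by (auto simp: mem_box_cart less_imp_le)
  have "measure lebesgue (cbox 0 (1::real^'n)) = 1"
    by (simp add: content_cbox_cart interval_ne_empty_cart)
  moreover have "measure lebesgue (box 0 (1::real^'n)) = measure lebesgue (cbox 0 (1::real^'n))"
    by (simp add: measure_lborel_box_eq measure_lborel_cbox_eq)
  moreover have "measure lebesgue (box 0 (1::real^'n)) \<le> measure lebesgue ?Q"
  proof (rule measure_mono_fmeasurable[OF sub(1)])
    show "?Q \<in> lmeasurable"
      using fundamental_domain_unit_cube bounded_set_imp_lmeasurable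
      unfolding fundamental_domain_def by blast
  qed auto
  moreover have "measure lebesgue ?Q \<le> measure lebesgue (cbox 0 (1::real^'n))"
    using sub Q by (intro measure_mono_fmeasurable) auto
  ultimately have "measure lebesgue ?Q = 1" by simp
  moreover have "(LINT v:D|lebesgue. (1::real)) = (LINT v:?Q|lebesgue. 1)"
    by (rule fundamental_domain_exchange[OF assms fundamental_domain_unit_cube, where b = 1]) auto
  ultimately show ?thesis by (simp add: set_lebesgue_integral_def Q)
qed

section \<open>Integrals of characters over a fundamental domain\<close>

lemma measurable_character: "character \<xi> \<in> borel_measurable lebesgue"
  using continuous_imp_measurable_on_sets_lebesgue[OF continuous_on_character, of UNIV]
  by (simp add: lebesgue_on_UNIV_eq)

lemma measurable_trig_poly: "f \<in> trig_poly \<Longrightarrow> f \<in> borel_measurable lebesgue"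
  using continuous_imp_measurable_on_sets_lebesgue[OF continuous_on_trig_poly, of f UNIV]
  by (simp add: lebesgue_on_UNIV_eq)

lemma set_integrable_trig_poly:
  assumes "fundamental_domain D" "f \<in> trig_poly"
  shows "set_integrable lebesgue D f"
  using integrable_indicator_bounded[OF _ _ measurable_trig_poly] assms bounded_trig_poly[of f]
  by (metis fundamental_domain_def)

text \<open>For nonzero \<open>c\<close>, a suitable translation of the domain flips the sign of the
  integral, while the exchange lemma says that it preserves it.\<close>

lemma integral_character_fundamental_domain:
  fixes D :: "(real^'n) set"
  assumes "fundamental_domain D"
  shows "(LINT v:D|lebesgue. character (real_vec c) v) = (if c = 0 then 1 else 0)"
proof (cases "c = 0")
  case True
  then show ?thesis
    using measure_fundamental_domain[OF assms] assms
    by (simp add: set_lebesgue_integral_def fundamental_domain_def scaleR_conv_of_real)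
next
  case False
  then obtain i where i: "c $ i \<noteq> 0" by (auto simp: vec_eq_iff)
  \<comment> \<open>Half a period in a coordinate where \<open>c\<close> is nonzero, so that the
    character takes the value -1 at \<open>t\<close>.\<close>
  define t :: "real^'n" where "t = axis i (1 / (2 * c $ i))"
  have half: "real_vec c \<bullet> t = 1 / 2"
    using i by (simp add: t_def inner_axis real_vec_def)
  then have t: "character (real_vec c) t = -1"
    unfolding character_def half by simp
  let ?f = "\<lambda>v. indicator ((+) t ` D) v *\<^sub>R character (real_vec c) v"
  have D: "D \<in> sets lebesgue" "(+) t ` D \<in> sets lebesgue"
    using assms fundamental_domain_translation[OF assms] by (auto simp: fundamental_domain_def)
  have "(LINT v:D|lebesgue. character (real_vec c) v) = (LINT v:(+) t ` D|lebesgue. character (real_vec c) v)"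
    by (rule fundamental_domain_exchange[OF assms fundamental_domain_translation[OF assms], where b = 1])
      (simp_all add: measurable_character character_add_right)
  also have "\<dots> = (LINT v|lebesgue. ?f (t + v))"
    unfolding set_lebesgue_integral_def
    using D measurable_character by (intro integral_lebesgue_translation[symmetric] borel_measurable_scaleR) auto
  also have "\<dots> = (LINT v:D|lebesgue. - character (real_vec c) v)"
    unfolding set_lebesgue_integral_def
    by (rule Bochner_Integration.integral_cong) (auto simp: indicator_def character_add_right t)
  also have "\<dots> = - (LINT v:D|lebesgue. character (real_vec c) v)"
    by (simp add: set_lebesgue_integral_def)
  finally show ?thesis using False by simp
qed


subsection \<open>Trigonometric approximation of almost everywhere continuous functions\<close>

text \<open>The error has a pointwise majorant \<open>h\<close> that is itself a trigonometric
  polynomial. A bound on the integral of the error alone would say nothing about its averages over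
  the countable set of sample points, whereas those of \<open>h\<close> can be computed.\<close>

definition trig_approximable :: "(real ^ 'n) set \<Rightarrow> (real ^ 'n \<Rightarrow> complex) \<Rightarrow> bool" where
  "trig_approximable D w \<longleftrightarrow> (\<forall>e>0. \<exists>p\<in>trig_poly. \<exists>h. (\<lambda>v. complex_of_real (h v)) \<in> trig_poly \<and>
     (\<forall>v. norm (w v - p v) \<le> h v) \<and> (LINT v:D|lebesgue. h v) \<le> e)"

lemma set_integrable_real_trig_poly:
  assumes "fundamental_domain D" "(\<lambda>v. complex_of_real (h v)) \<in> trig_poly"
  shows "set_integrable lebesgue D h"
proof -
  have "integrable lebesgue (\<lambda>v. Re (indicator D v *\<^sub>R complex_of_real (h v)))"
    using set_integrable_trig_poly[OF assms] by (intro integrable_Re) (simp add: set_integrable_def)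
  then show ?thesis by (simp add: set_integrable_def)
qed

text \<open>The envelopes of \<open>w\<close> and of its negative squeeze \<open>w\<close> between
  two continuous periodic functions. Their gap tends to 0 at every continuity point of
  \<open>w\<close>, hence in mean by dominated convergence, and both envelopes are uniformly close
  to trigonometric polynomials.\<close>

lemma trig_approximable_real:
  fixes w :: "real ^ 'n \<Rightarrow> real"
  assumes D: "fundamental_domain D"
    and bound: "\<And>v. \<bar>w v\<bar> \<le> M"
    and periodic: "\<And>v z. w (v + real_vec z) = w v"
    and cont: "negligible {v. \<not> isCont w v}"
  shows "trig_approximable D (\<lambda>v. complex_of_real (w v))"
  unfolding trig_approximable_def
proof (intro allI impI)
  fix e :: real assume "e > 0"
  define \<phi> where "\<phi> k v = upper_envelope w k (torus_point v)" for k v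
  define \<psi> where "\<psi> k v = - upper_envelope (\<lambda>v. - w v) k (torus_point v)" for k v
  have bound': "\<bar>- w v\<bar> \<le> M" for v using bound by simp
  have DM: "D \<in> sets lebesgue" "bounded D" using D by (auto simp: fundamental_domain_def)
  have env: "\<psi> k v \<le> w v" "w v \<le> \<phi> k v" "\<phi> k v - \<psi> k v \<le> 2 * M" for k v
    using upper_envelope_ge[where w=w, OF bound, where v=v and k=k] upper_envelope_ge[where w="\<lambda>v. - w v", OF bound', where v=v and k=k]
      upper_envelope_le[where w=w, OF bound, where k=k and z="torus_point v"]
      upper_envelope_le[where w="\<lambda>v. - w v", OF bound', where k=k and z="torus_point v"]
    by (simp_all add: \<phi>_def \<psi>_def)
  have "continuous_on UNIV (\<lambda>v. \<phi> k v - \<psi> k v)" for k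
    unfolding \<phi>_def \<psi>_def
    by (intro continuous_intros continuous_on_compose2[OF continuous_on_upper_envelope[where w=w, OF bound, of UNIV]]
      continuous_on_compose2[OF continuous_on_upper_envelope[where w="\<lambda>v. - w v", OF bound', of UNIV]] continuous_on_torus_point) auto
  from continuous_imp_measurable_on_sets_lebesgue[OF this]
  have meas: "(\<lambda>v. \<phi> k v - \<psi> k v) \<in> borel_measurable lebesgue" for k
    by (simp add: lebesgue_on_UNIV_eq)
  have "(\<lambda>k. LINT v|lebesgue. indicator D v *\<^sub>R (\<phi> k v - \<psi> k v)) \<longlonglongrightarrow> (LINT v|(lebesgue :: (real^'n) measure). 0)"
  proof (rule integral_dominated_convergence)
    show "(\<lambda>v. indicator D v *\<^sub>R (\<phi> k v - \<psi> k v)) \<in> borel_measurable lebesgue" for k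
      using meas DM by measurable
    show "integrable lebesgue (\<lambda>v. indicator D v *\<^sub>R (2 * M))"
      using integrable_indicator_bounded[OF DM, of "\<lambda>_. 2 * M" "\<bar>2 * M\<bar>"] by (simp add: set_integrable_def)
    have "AE v in lebesgue. v \<notin> {v. \<not> isCont w v}"
      using cont unfolding negligible_iff_null_sets by (rule AE_not_in)
    then show "AE v in lebesgue. (\<lambda>k. indicator D v *\<^sub>R (\<phi> k v - \<psi> k v)) \<longlonglongrightarrow> 0"
    proof (rule AE_mp, intro AE_I2 impI)
      fix v assume "v \<notin> {v. \<not> isCont w v}"
      then have v: "isCont w v" "isCont (\<lambda>v. - w v) v" by auto
      have "(\<lambda>k. \<phi> k v) \<longlonglongrightarrow> w v"
        unfolding \<phi>_def using bound periodic v(1) by (rule upper_envelope_tendsto)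
      moreover have "(\<lambda>k. upper_envelope (\<lambda>v. - w v) k (torus_point v)) \<longlonglongrightarrow> - w v"
        by (rule upper_envelope_tendsto[where w="\<lambda>v. - w v", OF bound']) (simp_all add: periodic v(2))
      then have "(\<lambda>k. \<psi> k v) \<longlonglongrightarrow> w v"
        unfolding \<psi>_def using tendsto_minus by fastforce
      ultimately have "(\<lambda>k. indicator D v *\<^sub>R (\<phi> k v - \<psi> k v)) \<longlonglongrightarrow> indicator D v *\<^sub>R (w v - w v)"
        by (intro tendsto_intros)
      then show "(\<lambda>k. indicator D v *\<^sub>R (\<phi> k v - \<psi> k v)) \<longlonglongrightarrow> 0" by simp
    qed
    show "AE v in lebesgue. norm (indicator D v *\<^sub>R (\<phi> k v - \<psi> k v)) \<le> indicator D v *\<^sub>R (2 * M)" for k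
    proof (rule AE_I2)
      fix v show "norm (indicator D v *\<^sub>R (\<phi> k v - \<psi> k v)) \<le> indicator D v *\<^sub>R (2 * M)"
        using env[where k=k and v=v] by (auto simp: indicator_def)
    qed
  qed simp
  then have "\<forall>\<^sub>F k in sequentially. (LINT v:D|lebesgue. \<phi> k v - \<psi> k v) < e / 2"
    unfolding set_lebesgue_integral_def using \<open>e > 0\<close> by (intro order_tendstoD) auto
  then obtain k where k: "(LINT v:D|lebesgue. \<phi> k v - \<psi> k v) < e / 2"
    using eventually_happens'[OF sequentially_bot] by blast
  have e8: "e / 8 > 0" using \<open>e > 0\<close> by simp
  obtain g1 where g1: "(\<lambda>v. complex_of_real (g1 v)) \<in> trig_poly" "\<And>v. \<bar>\<phi> k v - g1 v\<bar> < e / 8"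
    using trig_poly_dense[OF continuous_on_upper_envelope[where w=w, OF bound] e8] unfolding \<phi>_def by metis
  obtain g2 where g2: "(\<lambda>v. complex_of_real (g2 v)) \<in> trig_poly"
      "\<And>v. \<bar>upper_envelope (\<lambda>v. - w v) k (torus_point v) - g2 v\<bar> < e / 8"
    using trig_poly_dense[OF continuous_on_upper_envelope[where w="\<lambda>v. - w v", OF bound'] e8] by metis
  have g2': "\<bar>\<psi> k v + g2 v\<bar> < e / 8" for v
    using g2(2)[of v] by (simp add: \<psi>_def abs_minus_commute)
  \<comment> \<open>\<open>g1\<close> + e/8 lies above \<phi>, and - \<open>g2\<close> - e/8 lies
    below \<psi>; \<open>h\<close> is the difference of these two bounds. It exceeds the gap \<phi>
    - \<psi> by at most e/2, and the integral of the gap is below e/2.\<close>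
  define h where "h v = g1 v + g2 v + e / 4" for v
  show "\<exists>p\<in>trig_poly. \<exists>h. (\<lambda>v. complex_of_real (h v)) \<in> trig_poly \<and>
     (\<forall>v. norm (complex_of_real (w v) - p v) \<le> h v) \<and> (LINT v:D|lebesgue. h v) \<le> e"
  proof (intro bexI exI conjI allI)
    show p: "(\<lambda>v. complex_of_real (g1 v) + complex_of_real (e / 8)) \<in> trig_poly"
      by (intro trig_poly_add g1 trig_poly_const)
    have "(\<lambda>v. complex_of_real (g1 v) + complex_of_real (g2 v) + complex_of_real (e / 4)) \<in> trig_poly"
      by (intro trig_poly_add g1 g2 trig_poly_const)
    then show h: "(\<lambda>v. complex_of_real (h v)) \<in> trig_poly"
      by (simp add: h_def)
    show "norm (complex_of_real (w v) - (complex_of_real (g1 v) + complex_of_real (e / 8))) \<le> h v" for v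
    proof -
      have "norm (complex_of_real (w v) - (complex_of_real (g1 v) + complex_of_real (e / 8)))
          = \<bar>w v - (g1 v + e / 8)\<bar>"
        by (metis norm_of_real of_real_add of_real_diff real_norm_def)
      also have "\<dots> \<le> g1 v + g2 v + e / 4"
        using env[where k=k and v=v] g1(2)[of v] g2'[of v] by linarith
      finally show ?thesis by (simp only: h_def)
    qed
    have int: "set_integrable lebesgue D (\<lambda>v. \<phi> k v - \<psi> k v)"
    proof (rule integrable_indicator_bounded[OF DM meas])
      show "norm (\<phi> k v - \<psi> k v) \<le> 2 * M" for v using env[where k=k and v=v] by simp
    qed
    have int_c: "set_integrable lebesgue D (\<lambda>v. e / 2)"
      by (rule integrable_indicator_bounded[OF DM, where b = "\<bar>e / 2\<bar>"]) auto
    have "(LINT v:D|lebesgue. h v) \<le> (LINT v:D|lebesgue. (\<phi> k v - \<psi> k v) + e / 2)"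
    proof (rule set_integral_mono)
      show "set_integrable lebesgue D h" by (rule set_integrable_real_trig_poly[OF D h])
      show "set_integrable lebesgue D (\<lambda>v. (\<phi> k v - \<psi> k v) + e / 2)"
        using int int_c by (rule set_integral_add)
      show "h v \<le> (\<phi> k v - \<psi> k v) + e / 2" for v
        unfolding h_def using g1(2)[of v] g2'[of v] by linarith
    qed
    also have "\<dots> = (LINT v:D|lebesgue. \<phi> k v - \<psi> k v) + (LINT v:D|lebesgue. e / 2)"
      using int int_c by (rule set_integral_add)
    also have "(LINT v:D|lebesgue. e / 2) = e / 2"
      using measure_fundamental_domain[OF D] DM by (simp add: set_lebesgue_integral_def)
    finally show "(LINT v:D|lebesgue. h v) \<le> e" using k by linarith
  qed
qed

lemma trig_approximable_complex:
  fixes w :: "real ^ 'n \<Rightarrow> complex"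
  assumes D: "fundamental_domain D"
    and bound: "\<And>v. norm (w v) \<le> M"
    and periodic: "\<And>v z. w (v + real_vec z) = w v"
    and cont: "negligible {v. \<not> isCont w v}"
  shows "trig_approximable D w"
  unfolding trig_approximable_def
proof (intro allI impI)
  fix e :: real assume "e > 0"
  have "trig_approximable D (\<lambda>v. complex_of_real (Re (w v)))"
  proof (rule trig_approximable_real[OF D])
    show "\<bar>Re (w v)\<bar> \<le> M" for v using abs_Re_le_cmod bound order_trans by blast
    show "negligible {v. \<not> isCont (\<lambda>v. Re (w v)) v}"
      by (rule negligible_subset[OF cont]) (auto intro: isCont_Re)
  qed (simp add: periodic)
  then obtain p h where p: "p \<in> trig_poly" "(\<lambda>v. complex_of_real (h v)) \<in> trig_poly"
    "\<And>v. norm (complex_of_real (Re (w v)) - p v) \<le> h v" "(LINT v:D|lebesgue. h v) \<le> e / 2"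
    unfolding trig_approximable_def using \<open>e > 0\<close> by (meson half_gt_zero)
  have "trig_approximable D (\<lambda>v. complex_of_real (Im (w v)))"
  proof (rule trig_approximable_real[OF D])
    show "\<bar>Im (w v)\<bar> \<le> M" for v using abs_Im_le_cmod bound order_trans by blast
    show "negligible {v. \<not> isCont (\<lambda>v. Im (w v)) v}"
      by (rule negligible_subset[OF cont]) (auto intro: isCont_Im)
  qed (simp add: periodic)
  then obtain q k where q: "q \<in> trig_poly" "(\<lambda>v. complex_of_real (k v)) \<in> trig_poly"
    "\<And>v. norm (complex_of_real (Im (w v)) - q v) \<le> k v" "(LINT v:D|lebesgue. k v) \<le> e / 2"
    unfolding trig_approximable_def using \<open>e > 0\<close> by (meson half_gt_zero)
  show "\<exists>p\<in>trig_poly. \<exists>h. (\<lambda>v. complex_of_real (h v)) \<in> trig_poly \<and>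
     (\<forall>v. norm (w v - p v) \<le> h v) \<and> (LINT v:D|lebesgue. h v) \<le> e"
  proof (intro bexI exI conjI allI)
    show "(\<lambda>v. p v + \<i> * q v) \<in> trig_poly" by (intro trig_poly_add trig_poly_scale p q)
    show "(\<lambda>v. complex_of_real (h v + k v)) \<in> trig_poly"
      using trig_poly_add[OF p(2) q(2)] by simp
    show "norm (w v - (p v + \<i> * q v)) \<le> h v + k v" for v
    proof -
      have "w v - (p v + \<i> * q v) = (complex_of_real (Re (w v)) - p v) + \<i> * (complex_of_real (Im (w v)) - q v)"
        using complex_eq[of "w v"] by (simp add: algebra_simps)
      also have "norm \<dots> \<le> norm (complex_of_real (Re (w v)) - p v) + norm (complex_of_real (Im (w v)) - q v)"
        by (rule norm_triangle_le) (simp add: norm_mult)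
      finally show ?thesis using p(3)[of v] q(3)[of v] by linarith
    qed
    have "(LINT v:D|lebesgue. h v + k v) = (LINT v:D|lebesgue. h v) + (LINT v:D|lebesgue. k v)"
      by (intro set_integral_add set_integrable_real_trig_poly[OF D] p q)
    then show "(LINT v:D|lebesgue. h v + k v) \<le> e" using p(4) q(4) by linarith
  qed
qed


subsection \<open>Uniform means over boxes\<close>

text \<open>Convergence along this filter means: as the shortest side grows, uniformly in the
  position and the shape of the box.\<close>

definition boxes_filter :: "(int ^ 'n) set filter" where
  "boxes_filter = (INF N. principal (boxes N))"

lemma boxes_antimono: "M \<le> N \<Longrightarrow> boxes N \<subseteq> boxes M"
  by (auto simp: boxes_def intro: order_trans)

lemma eventually_boxes_filter: "eventually P boxes_filter \<longleftrightarrow> (\<exists>N. \<forall>B\<in>boxes N. P B)"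
  unfolding boxes_filter_def
  by (subst eventually_INF_base)
    (auto simp: eventually_principal intro: boxes_antimono[THEN subsetD] max.cobounded1 max.cobounded2)

lemma eventually_boxes_filterI: "(\<And>B. B \<in> boxes N \<Longrightarrow> P B) \<Longrightarrow> eventually P boxes_filter"
  by (auto simp: eventually_boxes_filter)

definition box_average :: "(int ^ 'n \<Rightarrow> 'a::real_vector) \<Rightarrow> (int ^ 'n) set \<Rightarrow> 'a" where
  "box_average \<phi> B = (\<Sum>x\<in>B. \<phi> x) /\<^sub>R card B"

definition has_box_mean :: "(int ^ 'n \<Rightarrow> 'a::real_normed_vector) \<Rightarrow> 'a \<Rightarrow> bool" where
  "has_box_mean \<phi> m \<longleftrightarrow> (box_average \<phi> \<longlongrightarrow> m) boxes_filter"

lemma sum_box_lattice: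
  fixes g :: "'n::finite \<Rightarrow> int \<Rightarrow> 'a::{real_normed_field, banach, second_countable_topology}"
  shows "(\<Sum>x\<in>box_lattice a l. \<Prod>i\<in>UNIV. g i (x $ i))
    = (\<Prod>i\<in>UNIV. \<Sum>t\<in>{a $ i..<a $ i + int (l $ i)}. g i t)"
proof -
  let ?I = "\<lambda>i. {a $ i..<a $ i + int (l $ i)}"
  have bij: "bij_betw vec_lambda (PiE UNIV ?I) (box_lattice a l)"
    by (rule bij_betw_byWitness[where f' = vec_nth]) (auto simp: box_lattice_def PiE_UNIV_domain)
  have "(\<Sum>x\<in>box_lattice a l. \<Prod>i\<in>UNIV. g i (x $ i)) = (\<Sum>f\<in>PiE UNIV ?I. \<Prod>i\<in>UNIV. g i (f i))"
    by (subst sum.reindex_bij_betw[OF bij, symmetric]) simp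
  \<comment> \<open>The detour through \<open>infsetsum\<close> gives access to the product formula
    over \<open>PiE\<close>; on these finite sets it is the ordinary sum.\<close>
  also have "\<dots> = infsetsum (\<lambda>f. \<Prod>i\<in>UNIV. g i (f i)) (PiE UNIV ?I)"
    by (simp add: finite_PiE)
  also have "\<dots> = (\<Prod>i\<in>UNIV. infsetsum (g i) (?I i))"
    by (rule infsetsum_prod_PiE) (auto intro: abs_summable_on_finite)
  finally show ?thesis by simp
qed

lemma finite_box_lattice [simp]: "finite (box_lattice a l)"
proof -
  have "box_lattice a l = vec_lambda ` PiE UNIV (\<lambda>i. {a $ i..<a $ i + int (l $ i)})"
    by (auto simp: box_lattice_def PiE_UNIV_domain image_iff intro!: bexI[of _ "vec_nth _"])
  then show ?thesis by (simp add: finite_PiE)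
qed

lemma card_box_lattice: "real (card (box_lattice a l)) = (\<Prod>i\<in>UNIV. real (l $ i))"
  using sum_box_lattice[where g = "\<lambda>_ _. 1::real", of a l] by simp

lemma boxes_E:
  assumes "B \<in> boxes N"
  obtains a l where "B = box_lattice a l" "\<And>i. N \<le> l $ i"
  using assms unfolding boxes_def by (auto simp: Min_ge_iff)

lemma boxes_card_pos:
  assumes "B \<in> boxes N" "N \<ge> 1"
  shows "finite B" "card B > 0"
proof -
  obtain a l where B: "B = box_lattice a l" "\<And>i. N \<le> l $ i" using boxes_E[OF assms(1)] by metis
  then show "finite B" by simp
  have "l $ i > 0" for i using B(2)[of i] assms(2) by simp
  then have "(\<Prod>i\<in>UNIV. real (l $ i)) > 0" by (intro prod_pos) auto
  then show "card B > 0" using B card_box_lattice[of a l] by simp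
qed

lemma has_box_mean_add:
  "has_box_mean f m \<Longrightarrow> has_box_mean g k \<Longrightarrow> has_box_mean (\<lambda>y. f y + g y) (m + k)"
  unfolding has_box_mean_def box_average_def
  by (simp add: sum.distrib scaleR_add_right tendsto_add)

lemma has_box_mean_mult_left:
  fixes f :: "int ^ 'n \<Rightarrow> complex"
  assumes "has_box_mean f m"
  shows "has_box_mean (\<lambda>y. c * f y) (c * m)"
proof -
  have "box_average (\<lambda>y. c * f y) = (\<lambda>B. c * box_average f B)"
    by (simp add: box_average_def fun_eq_iff sum_distrib_left)
  then show ?thesis using assms unfolding has_box_mean_def by (simp add: tendsto_mult_left)
qed

lemma has_box_mean_sum:
  fixes f :: "'i \<Rightarrow> int ^ 'n \<Rightarrow> 'a::real_normed_vector"
  shows "finite A \<Longrightarrow> (\<And>i. i \<in> A \<Longrightarrow> has_box_mean (f i) (m i)) \<Longrightarrow>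
    has_box_mean (\<lambda>y. \<Sum>i\<in>A. f i y) (\<Sum>i\<in>A. m i)"
proof (induction A rule: finite_induct)
  case empty
  have "box_average (\<lambda>y :: int ^ 'n. 0 :: 'a) = (\<lambda>B. 0)" by (simp add: box_average_def fun_eq_iff)
  then show ?case unfolding has_box_mean_def by simp
next
  case (insert i A)
  then show ?case by (simp add: has_box_mean_add)
qed

lemma has_box_mean_const: "has_box_mean (\<lambda>y. c) c"
  unfolding has_box_mean_def
proof (rule tendsto_eventually, rule eventually_boxes_filterI[where N = 1])
  fix B :: "(int ^ 'n) set" assume "B \<in> boxes 1"
  from boxes_card_pos(2)[OF this] have "inverse (real (card B)) * real (card B) = 1"
    by (intro left_inverse) linarith
  then show "box_average (\<lambda>y. c) B = c"
    by (simp add: box_average_def sum_constant_scaleR)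
qed

section \<open>Box means of characters and the link to frequency\<close>

lemma norm_geometric_sum_le:
  fixes z :: complex
  assumes "norm z = 1" "z \<noteq> 1"
  shows "norm (\<Sum>t<(n::nat). z ^ t) \<le> 2 / norm (z - 1)"
proof -
  have "(\<Sum>t<n. z ^ t) = (z ^ n - 1) / (z - 1)"
    using assms(2) by (rule geometric_sum)
  moreover have "norm (z ^ n - 1) \<le> 2"
    using norm_triangle_ineq4[of "z ^ n" 1] assms(1) by (simp add: norm_power)
  ultimately show ?thesis by (simp add: norm_divide divide_right_mono)
qed

lemma norm_sum_cis_le:
  assumes "x \<notin> \<int>"
  shows "norm (\<Sum>t\<in>{a..<a + int n}. cis (2 * pi * (x * real_of_int t))) \<le> 2 / norm (cis (2 * pi * x) - 1)"
proof -
  have neq: "cis (2 * pi * x) \<noteq> 1"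
  proof
    assume "cis (2 * pi * x) = 1"
    then have "cos (2 * pi * x) = 1" by (metis cis.sel(1) one_complex.sel(1))
    then obtain m :: int where "2 * pi * x = of_int m * 2 * pi"
      by (auto simp: cos_one_2pi_int)
    then have "x = of_int m" by simp
    with assms show False by auto
  qed
  have "(\<Sum>t\<in>{a..<a + int n}. cis (2 * pi * (x * real_of_int t)))
      = (\<Sum>t<n. cis (2 * pi * (x * real_of_int (a + int t))))"
  proof (rule sum.reindex_bij_witness[of _ "\<lambda>t. a + int t" "\<lambda>t. nat (t - a)"])
  qed auto
  also have "\<dots> = cis (2 * pi * (x * a)) * (\<Sum>t<n. cis (2 * pi * x) ^ t)"
    by (simp add: sum_distrib_left Complex.DeMoivre cis_mult algebra_simps)
  also have "norm \<dots> = norm (\<Sum>t<n. cis (2 * pi * x) ^ t)"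
    by (simp add: norm_mult)
  also have "\<dots> \<le> 2 / norm (cis (2 * pi * x) - 1)"
    by (rule norm_geometric_sum_le) (simp_all add: neq)
  finally show ?thesis .
qed

text \<open>The sum over a box factors into one-dimensional sums. In a coordinate where \<xi> is not
  an integer the factor is a bounded geometric sum; every other factor is at most the side length,
  so the average decays like the reciprocal of one side.\<close>

lemma has_box_mean_character:
  fixes \<xi> :: "real ^ 'n"
  assumes "\<xi> \<notin> range real_vec"
  shows "has_box_mean (\<lambda>y. character \<xi> (real_vec y)) 0"
proof -
  obtain j where j: "\<xi> $ j \<notin> \<int>"
  proof (rule ccontr)
    assume "\<not> thesis"
    then have "\<forall>j. \<exists>m. \<xi> $ j = of_int m" using that by (auto elim!: Ints_cases)
    then obtain m where "\<And>j. \<xi> $ j = of_int (m j)" by metis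
    then have "\<xi> = real_vec (\<chi> j. m j)" by (simp add: vec_eq_iff real_vec_def)
    with assms show False by blast
  qed
  define K where "K = 2 / norm (cis (2 * pi * \<xi> $ j) - 1)"
  have bound: "norm (box_average (\<lambda>y. character \<xi> (real_vec y)) B) \<le> K / N" if B: "B \<in> boxes N" "N \<ge> 1" for B N
  proof -
    obtain a l where l: "B = box_lattice a l" "\<And>i. N \<le> l $ i" using boxes_E[OF B(1)] by metis
    have pos: "real (l $ i) > 0" for i using l(2)[of i] B(2) by simp
    let ?s = "\<lambda>i. \<Sum>t\<in>{a $ i..<a $ i + int (l $ i)}. cis (2 * pi * (\<xi> $ i * real_of_int t))"
    have char: "character \<xi> (real_vec y) = (\<Prod>i\<in>UNIV. cis (2 * pi * (\<xi> $ i * real_of_int (y $ i))))" for y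
    proof -
      have "(\<Prod>i\<in>S. cis (f i)) = cis (\<Sum>i\<in>S. f i)" if "finite S" for f :: "'n \<Rightarrow> real" and S
        using that by (induction S) (auto simp: cis_mult)
      then show ?thesis
        by (simp add: character_def inner_vec_def real_vec_def sum_distrib_left)
    qed
    have "norm (\<Sum>y\<in>B. character \<xi> (real_vec y)) = (\<Prod>i\<in>UNIV. norm (?s i))"
      unfolding l(1) char
      by (subst sum_box_lattice[where g = "\<lambda>i t. cis (2 * pi * (\<xi> $ i * real_of_int t))"]) (simp add: prod_norm)
    also have "\<dots> = norm (?s j) * (\<Prod>i\<in>UNIV - {j}. norm (?s i))"
      by (simp add: prod.remove)
    also have "\<dots> \<le> K * (\<Prod>i\<in>UNIV - {j}. real (l $ i))"
    proof (intro mult_mono prod_mono conjI prod_nonneg)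
      show "norm (?s j) \<le> K" unfolding K_def by (rule norm_sum_cis_le[OF j])
      show "norm (?s i) \<le> real (l $ i)" for i
        using norm_sum[of "\<lambda>t. cis (2 * pi * (\<xi> $ i * real_of_int t))" "{a $ i..<a $ i + int (l $ i)}"] by simp
    qed (auto simp: K_def)
    also have "\<dots> = K / real (l $ j) * (\<Prod>i\<in>UNIV. real (l $ i))"
      using pos[of j] by (simp add: prod.remove[of UNIV j])
    finally have "norm (\<Sum>y\<in>B. character \<xi> (real_vec y)) \<le> K / real (l $ j) * real (card B)"
      by (simp add: l(1) card_box_lattice)
    then have "norm (box_average (\<lambda>y. character \<xi> (real_vec y)) B) \<le> K / real (l $ j)"
      using boxes_card_pos[OF B] pos[of j] by (simp add: box_average_def field_simps)
    also have "\<dots> \<le> K / N"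
      using l(2)[of j] B(2) by (intro divide_left_mono) (auto simp: K_def)
    finally show ?thesis .
  qed
  show ?thesis unfolding has_box_mean_def
  proof (rule tendstoI)
    fix e :: real assume "e > 0"
    obtain N :: nat where N: "K / e < N" using reals_Archimedean2 by blast
    have "K \<ge> 0" by (simp add: K_def)
    then have "N \<ge> 1" using N \<open>e > 0\<close>
      by (metis One_nat_def Suc_leI divide_nonneg_pos not_gr_zero of_nat_0 not_less)
    have "K / N < e" using N \<open>e > 0\<close> \<open>N \<ge> 1\<close> by (simp add: field_simps)
    then show "\<forall>\<^sub>F B in boxes_filter. dist (box_average (\<lambda>y. character \<xi> (real_vec y)) B) 0 < e"
      using bound[OF _ \<open>N \<ge> 1\<close>] by (intro eventually_boxes_filterI[of N]) (auto intro: le_less_trans)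
  qed
qed

text \<open>If all boxes in some \<open>boxes N\<close> have density within e of \<open>m\<close>,
  then the infimum and supremum over that family are too. Conversely every \<open>boxes N\<close>
  contains such boxes, because the families are nested and nonempty.\<close>

lemma frequency_eq_box_mean:
  fixes A :: "(int ^ 'n) set"
  assumes "has_box_mean (indicat_real A) m"
  shows "frequency_measurable A" "frequency A = m"
proof -
  define q where "q P = real (card (A \<inter> P)) / real (card P)" for P
  have q01: "0 \<le> q P" "q P \<le> 1" if "P \<in> boxes N" "N \<ge> 1" for P N
    using boxes_card_pos[OF that] card_mono[of P "A \<inter> P"] by (auto simp: q_def divide_le_eq_1)
  have ne: "boxes N \<noteq> ({} :: (int ^ 'n) set set)" for N :: nat
  proof -
    have "box_lattice 0 (\<chi> i. N) \<in> (boxes N :: (int ^ 'n) set set)"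
      unfolding boxes_def by (auto simp: Min_ge_iff intro!: exI[of _ 0] exI[of _ "\<chi> i. N"])
    then show ?thesis by blast
  qed
  have bdd: "bdd_below (q ` boxes N)" "bdd_above (q ` boxes N)" if "N \<ge> 1" for N
    using q01 that by (auto intro!: bdd_belowI[of _ 0] bdd_aboveI[of _ 1])
  have avg: "box_average (indicat_real A) P = q P" if "P \<in> boxes N" "N \<ge> 1" for P N
    using boxes_card_pos[OF that]
    by (simp add: box_average_def q_def indicator_def of_bool_def sum.If_cases Int_commute divide_inverse mult.commute)
  have close: "\<exists>N\<ge>1. \<forall>P\<in>boxes N. \<bar>q P - m\<bar> \<le> e" if "e > 0" for e
  proof -
    obtain N where "\<forall>P\<in>boxes N. dist (box_average (indicat_real A) P) m < e"
      using tendstoD[OF assms[unfolded has_box_mean_def] \<open>e > 0\<close>] by (auto simp: eventually_boxes_filter)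
    then have N: "dist (box_average (indicat_real A) P) m < e" if "P \<in> boxes N" for P using that by blast
    \<comment> \<open>The filter may deliver N = 0. Passing to at least 1 excludes empty boxes and
      stays in the index range of the outer supremum and infimum.\<close>
    have "\<bar>q P - m\<bar> \<le> e" if "P \<in> boxes (max N 1)" for P
    proof -
      have "P \<in> boxes N" using that boxes_antimono[of N "max N 1", THEN subsetD] by simp
      moreover have "box_average (indicat_real A) P = q P" using that by (intro avg) auto
      ultimately show ?thesis using N[of P] by (simp add: dist_real_def)
    qed
    then show ?thesis by (intro exI[of _ "max N 1"]) auto
  qed
  have lower: "lower_frequency A = (SUP N\<in>{1..}. INF P\<in>boxes N. q P)"
    and upper: "upper_frequency A = (INF N\<in>{1..}. SUP P\<in>boxes N. q P)"
    by (simp_all add: lower_frequency_def upper_frequency_def q_def)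
  have compare: "\<exists>P\<in>boxes N. \<bar>q P - m\<bar> \<le> e" if "e > 0" for e N
  proof -
    obtain N' where N': "\<forall>P\<in>boxes N'. \<bar>q P - m\<bar> \<le> e" using close[OF \<open>e > 0\<close>] by blast
    obtain P :: "(int ^ 'n) set" where "P \<in> boxes (max N N')" using ne[of "max N N'"] by blast
    moreover have "boxes (max N N') \<subseteq> (boxes N :: (int ^ 'n) set set)" by (rule boxes_antimono) simp
    moreover have "boxes (max N N') \<subseteq> (boxes N' :: (int ^ 'n) set set)" by (rule boxes_antimono) simp
    ultimately have "P \<in> boxes N" "P \<in> boxes N'" by auto
    with N' show ?thesis by blast
  qed
  have inf_le: "(INF P\<in>boxes N. q P) \<le> m + e" if eN: "e > 0" "N \<ge> 1" for e N
  proof -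
    obtain P where P: "P \<in> boxes N" "\<bar>q P - m\<bar> \<le> e" using compare[OF eN(1), of N] by blast
    from P(2) have "q P \<le> m + e" by linarith
    with bdd(1)[OF eN(2)] P(1) show ?thesis by (rule cINF_lower2)
  qed
  have sup_ge: "m - e \<le> (SUP P\<in>boxes N. q P)" if eN: "e > 0" "N \<ge> 1" for e N
  proof -
    obtain P where P: "P \<in> boxes N" "\<bar>q P - m\<bar> \<le> e" using compare[OF eN(1), of N] by blast
    from P(2) have "m - e \<le> q P" by linarith
    with bdd(2)[OF eN(2)] P(1) show ?thesis by (rule cSUP_upper2)
  qed
  have "lower_frequency A \<le> m"
    unfolding lower
  proof (rule cSUP_least)
    fix N :: nat assume "N \<in> {1..}"
    show "(INF P\<in>boxes N. q P) \<le> m"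
    proof (rule field_le_epsilon)
      fix e :: real assume "e > 0"
      with inf_le[of e N] \<open>N \<in> {1..}\<close> show "(INF P\<in>boxes N. q P) \<le> m + e" by simp
    qed
  qed auto
  moreover have "m \<le> lower_frequency A"
  proof (rule field_le_epsilon)
    fix e :: real assume "e > 0"
    then obtain N where N: "N \<ge> 1" "\<forall>P\<in>boxes N. \<bar>q P - m\<bar> \<le> e" using close by blast
    have "m - e \<le> (INF P\<in>boxes N. q P)"
    proof (rule cINF_greatest[OF ne])
      fix P :: "(int ^ 'n) set" assume "P \<in> boxes N"
      with N(2) have "\<bar>q P - m\<bar> \<le> e" by blast
      then show "m - e \<le> q P" by linarith
    qed
    also have "\<dots> \<le> lower_frequency A"
      unfolding lower
    proof (rule cSUP_upper)
      show "bdd_above ((\<lambda>N. INF P\<in>boxes N. q P) ` {1..})"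
        by (rule bdd_aboveI2[of _ _ "m + 1"]) (rule inf_le, simp_all)
    qed (use N(1) in simp)
    finally show "m \<le> lower_frequency A + e" by simp
  qed
  moreover have "m \<le> upper_frequency A"
    unfolding upper
  proof (rule cINF_greatest)
    fix N :: nat assume "N \<in> {1..}"
    show "m \<le> (SUP P\<in>boxes N. q P)"
    proof (rule field_le_epsilon)
      fix e :: real assume "e > 0"
      with sup_ge[of e N] \<open>N \<in> {1..}\<close> show "m \<le> (SUP P\<in>boxes N. q P) + e" by simp
    qed
  qed auto
  moreover have "upper_frequency A \<le> m"
  proof (rule field_le_epsilon)
    fix e :: real assume "e > 0"
    then obtain N where N: "N \<ge> 1" "\<forall>P\<in>boxes N. \<bar>q P - m\<bar> \<le> e" using close by blast
    have "upper_frequency A \<le> (SUP P\<in>boxes N. q P)"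
      unfolding upper
    proof (rule cINF_lower)
      show "bdd_below ((\<lambda>N. SUP P\<in>boxes N. q P) ` {1..})"
        by (rule bdd_belowI2[of _ "m - 1"]) (rule sup_ge, simp_all)
    qed (use N(1) in simp)
    also have "\<dots> \<le> m + e"
    proof (rule cSUP_least[OF ne])
      fix P :: "(int ^ 'n) set" assume "P \<in> boxes N"
      with N(2) have "\<bar>q P - m\<bar> \<le> e" by blast
      then show "q P \<le> m + e" by linarith
    qed
    finally show "upper_frequency A \<le> m + e" .
  qed
  ultimately have "lower_frequency A = m" "upper_frequency A = m" by simp_all
  then show "frequency_measurable A" "frequency A = m"
    by (simp_all add: frequency_measurable_def frequency_def)
qed

text \<open>The means of the oscillating weight \<open>a\<close> do not control the approximation error; those of its
  majorant \<open>b\<close> do.\<close>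

lemma has_box_mean_approximable:
  fixes \<xi> :: "int ^ 'n \<Rightarrow> real ^ 'n" and a :: "int ^ 'n \<Rightarrow> complex" and b :: "int ^ 'n \<Rightarrow> real"
  assumes D: "fundamental_domain D"
    and ab: "\<And>y. norm (a y) \<le> b y"
    and a: "\<And>c. has_box_mean (\<lambda>y. a y * character (real_vec c) (\<xi> y)) (if c = 0 then \<alpha> else 0)"
    and b: "\<And>c. has_box_mean (\<lambda>y. of_real (b y) * character (real_vec c) (\<xi> y)) (if c = 0 then \<beta> else 0)"
    and w: "trig_approximable D w" "set_integrable lebesgue D w"
  shows "has_box_mean (\<lambda>y. a y * w (\<xi> y)) (\<alpha> * (LINT v:D|lebesgue. w v))"
proof -
  \<comment> \<open>By linearity it suffices to treat characters: only c = 0 has a nonzero mean,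
    just as only c = 0 has a nonzero integral.\<close>
  have trig: "has_box_mean (\<lambda>y. f y * p (\<xi> y)) (\<gamma> * (LINT v:D|lebesgue. p v))"
    if f: "\<And>c. has_box_mean (\<lambda>y. f y * character (real_vec c) (\<xi> y)) (if c = 0 then \<gamma> else 0)"
      and "p \<in> trig_poly" for f \<gamma> p
    using that(2)
  proof induction
    case (trig_poly_character c)
    show ?case using f[of c] by (simp add: integral_character_fundamental_domain[OF D] split: if_splits)
  next
    case (trig_poly_add p q)
    have "(LINT v:D|lebesgue. p v + q v) = (LINT v:D|lebesgue. p v) + (LINT v:D|lebesgue. q v)"
      by (intro set_integral_add set_integrable_trig_poly[OF D] trig_poly_add.hyps)
    then show ?case
      using has_box_mean_add[OF trig_poly_add.IH] by (simp add: algebra_simps)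
  next
    case (trig_poly_scale p c)
    then show ?case
      using has_box_mean_mult_left[OF trig_poly_scale.IH, of c] by (simp add: algebra_simps)
  qed
  show ?thesis unfolding has_box_mean_def
  proof (rule tendstoI)
    fix e :: real assume "e > 0"
    \<comment> \<open>The errors add up to (2 + |\<alpha>| + |\<beta>|) d: replacing
      \<open>w\<close> by \<open>p\<close> costs |\<beta>| d + d in the average and |\<alpha>| d in
      the integral, and the convergence for \<open>p\<close> costs d.\<close>
    define d where "d = e / (3 + norm \<alpha> + norm \<beta>)"
    have den: "3 + norm \<alpha> + norm \<beta> > 0" by (simp add: add_pos_nonneg)
    have "d > 0" unfolding d_def using \<open>e > 0\<close> den by simp
    obtain p h where p: "p \<in> trig_poly" and h: "(\<lambda>v. complex_of_real (h v)) \<in> trig_poly"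
      and ph: "\<And>v. norm (w v - p v) \<le> h v" and hd: "(LINT v:D|lebesgue. h v) \<le> d"
      using w(1) \<open>d > 0\<close> unfolding trig_approximable_def by metis
    let ?I = "\<lambda>f :: real^'n \<Rightarrow> complex. LINT v:D|lebesgue. f v"
    have intp: "set_integrable lebesgue D p" by (rule set_integrable_trig_poly[OF D p])
    have inth: "set_integrable lebesgue D h" by (rule set_integrable_real_trig_poly[OF D h])
    have h0: "h v \<ge> 0" for v using ph[of v] norm_ge_zero order_trans by blast
    have "norm (?I w - ?I p) = norm (LINT v:D|lebesgue. w v - p v)"
      by (simp add: set_integral_diff[OF w(2) intp])
    also have "\<dots> \<le> (LINT v:D|lebesgue. norm (w v - p v))"
      by (rule set_integral_norm_bound) (intro set_integral_diff w(2) intp)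
    also have "\<dots> \<le> (LINT v:D|lebesgue. h v)"
      by (rule set_integral_mono) (intro set_integrable_norm set_integral_diff w(2) intp inth ph)+
    finally have Iwp: "norm (?I w - ?I p) \<le> d" using hd by linarith
    have Ih: "norm (?I (\<lambda>v. complex_of_real (h v))) \<le> d"
    proof -
      have "?I (\<lambda>v. complex_of_real (h v)) = complex_of_real (LINT v:D|lebesgue. h v)"
        by (simp add: set_integral_complex_of_real)
      moreover have "(LINT v:D|lebesgue. h v) \<ge> 0"
        unfolding set_lebesgue_integral_def using h0 by (intro integral_nonneg_AE) (auto simp: indicator_def)
      ultimately show ?thesis using hd by simp
    qed
    have "\<forall>\<^sub>F B in boxes_filter. dist (box_average (\<lambda>y. a y * p (\<xi> y)) B) (\<alpha> * ?I p) < d"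
      using trig[of a \<alpha> p] a p \<open>d > 0\<close> unfolding has_box_mean_def by (intro tendstoD) auto
    moreover have "\<forall>\<^sub>F B in boxes_filter. dist (box_average (\<lambda>y. of_real (b y) * of_real (h (\<xi> y))) B)
        (\<beta> * ?I (\<lambda>v. complex_of_real (h v))) < d"
      using trig[of "\<lambda>y. of_real (b y)" \<beta> "\<lambda>v. complex_of_real (h v)"] b h \<open>d > 0\<close>
      unfolding has_box_mean_def by (intro tendstoD) auto
    ultimately show "\<forall>\<^sub>F B in boxes_filter. dist (box_average (\<lambda>y. a y * w (\<xi> y)) B) (\<alpha> * ?I w) < e"
    proof eventually_elim
      case (elim B)
      let ?A = "box_average (\<lambda>y. a y * w (\<xi> y)) B" and ?P = "box_average (\<lambda>y. a y * p (\<xi> y)) B"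
      let ?H = "box_average (\<lambda>y. complex_of_real (b y) * of_real (h (\<xi> y))) B"
      have "norm (?A - ?P) = norm (\<Sum>y\<in>B. a y * (w (\<xi> y) - p (\<xi> y))) / card B"
        by (simp add: box_average_def norm_divide divide_inverse mult.commute
            flip: scaleR_diff_right sum_subtractf right_diff_distrib)
      also have "\<dots> \<le> (\<Sum>y\<in>B. b y * h (\<xi> y)) / card B"
      proof (intro divide_right_mono sum_norm_le)
        fix y show "norm (a y * (w (\<xi> y) - p (\<xi> y))) \<le> b y * h (\<xi> y)"
          unfolding norm_mult using ab[of y] ph by (intro mult_mono) (auto intro: order_trans[OF norm_ge_zero])
      qed simp
      also have "\<dots> \<le> norm ?H"
      proof -
        have "?H = complex_of_real ((\<Sum>y\<in>B. b y * h (\<xi> y)) / card B)"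
          by (simp add: box_average_def scaleR_conv_of_real divide_inverse mult.commute)
        then show ?thesis by (metis abs_ge_self norm_of_real)
      qed
      also have "\<dots> \<le> norm (\<beta> * ?I (\<lambda>v. complex_of_real (h v))) + d"
        using elim(2) norm_triangle_ineq2[of ?H "\<beta> * ?I (\<lambda>v. complex_of_real (h v))"] by (simp add: dist_norm)
      also have "\<dots> \<le> norm \<beta> * d + d"
        using Ih by (simp add: norm_mult mult_left_mono)
      finally have AP: "norm (?A - ?P) \<le> norm \<beta> * d + d" .
      have "norm (\<alpha> * ?I p - \<alpha> * ?I w) \<le> norm \<alpha> * d"
        using Iwp by (simp add: norm_mult mult_left_mono norm_minus_commute flip: right_diff_distrib)
      moreover have "norm (?P - \<alpha> * ?I p) < d" using elim(1) by (simp add: dist_norm)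
      moreover have "?A - \<alpha> * ?I w = (?A - ?P) + (?P - \<alpha> * ?I p) + (\<alpha> * ?I p - \<alpha> * ?I w)" by simp
      ultimately have "norm (?A - \<alpha> * ?I w) < norm \<beta> * d + d + d + norm \<alpha> * d"
        using AP norm_triangle_ineq[of "(?A - ?P) + (?P - \<alpha> * ?I p)" "\<alpha> * ?I p - \<alpha> * ?I w"]
          norm_triangle_ineq[of "?A - ?P" "?P - \<alpha> * ?I p"] by simp
      also have "\<dots> \<le> (3 + norm \<alpha> + norm \<beta>) * d" using \<open>d > 0\<close> by (simp add: algebra_simps)
      also have "\<dots> = e" using den by (simp add: d_def)
      finally show ?case by (simp add: dist_norm)
    qed
  qed
qed


subsection \<open>Functions that are locally constant almost everywhere\<close>

text \<open>Almost everywhere continuity for functions with discrete values, here lattice points and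
  finite sets of them.\<close>

definition ae_locally_constant :: "('a::euclidean_space \<Rightarrow> 'b) \<Rightarrow> bool" where
  "ae_locally_constant f \<longleftrightarrow> negligible {u. \<not> (\<forall>\<^sub>F u' in nhds u. f u' = f u)}"

text \<open>A point of the level set outside its interior is a point where local constancy fails, so
  the level set is open up to a null set.\<close>

lemma ae_locally_constant_level_set:
  assumes "ae_locally_constant f"
  shows "{u. f u = b} \<in> sets lebesgue"
proof -
  let ?S = "{u. f u = b}"
  have "?S - interior ?S \<subseteq> {u. \<not> (\<forall>\<^sub>F u' in nhds u. f u' = f u)}"
    by (auto simp: eventually_nhds interior_def)
  then have "negligible (?S - interior ?S)"
    using assms negligible_subset unfolding ae_locally_constant_def by blast
  moreover have "?S = interior ?S \<union> (?S - interior ?S)" using interior_subset by blast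
  ultimately show ?thesis
    by (metis borel_open negligible_imp_sets open_interior sets.Un sets_completionI_sets sets_lborel)
qed

lemma negligible_UN_countable:
  assumes "\<And>i::'i::countable. negligible (S i)"
  shows "negligible (\<Union>i. S i)"
  using assms unfolding negligible_iff_null_sets by (intro null_sets_UN') auto


subsection \<open>The set-valued Markov chain of preimages\<close>

locale quantized_system =
  fixes R :: "real ^ 'n \<Rightarrow> int ^ 'n" and L :: "real ^ 'n ^ 'n"
  assumes quantizer: "quantizer R" and invertible: "invertible L"
begin

abbreviation "Linv \<equiv> matrix_inv L"
abbreviation "D \<equiv> shifted_cell R L"
abbreviation "shift \<equiv> (mat 1 + Linv) *v cell_mean R"

text \<open>The set inside the kernel, \<int>^n \<inter> (u + L^-1(A + R^-1(0))), written as a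
  preimage; \<open>transition_kernel_eq\<close> identifies the two.\<close>

definition pre :: "real ^ 'n \<Rightarrow> (int ^ 'n) set \<Rightarrow> (int ^ 'n) set" where
  "pre u A = {z. R (L *v (real_vec z - u)) \<in> A}"

lemma R_translate: "R (u + real_vec z) = R u + z"
  using quantizer by (simp add: quantizer_def)

lemma R_translate_diff: "R (u - real_vec z) = R u - z"
  using R_translate[of u "- z"] by (simp add: real_vec_uminus)

lemma L_Linv: "L ** Linv = mat 1" "Linv ** L = mat 1"
proof -
  have "\<exists>A'. L ** A' = mat 1 \<and> A' ** L = mat 1"
    using invertible by (simp add: invertible_def)
  then have "L ** Linv = mat 1 \<and> Linv ** L = mat 1"
    unfolding matrix_inv_def by (rule someI_ex)
  then show "L ** Linv = mat 1" "Linv ** L = mat 1" by auto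
qed

lemma L_Linv_vec [simp]: "L *v (Linv *v v) = v" "Linv *v (L *v v) = v"
  by (simp_all add: matrix_vector_mul_assoc L_Linv)

text \<open>\<open>R\<close> computes the integer part relative to the shifted cell. Uniqueness of
  this integer part is the tiling property of the cell.\<close>

lemma in_cell: "v - real_vec z \<in> D \<longleftrightarrow> R (v + shift) = z"
proof -
  have "v - real_vec z \<in> D \<longleftrightarrow> R ((v + shift) - real_vec z) = 0"
  proof
    assume "v - real_vec z \<in> D"
    then obtain u where "R u = 0" "v - real_vec z = u - shift"
      unfolding shifted_cell_def by auto
    moreover from this have "u = (v + shift) - real_vec z" by (simp add: algebra_simps)
    ultimately show "R ((v + shift) - real_vec z) = 0" by simp
  next
    assume "R ((v + shift) - real_vec z) = 0"
    then show "v - real_vec z \<in> D"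
      unfolding shifted_cell_def by (intro image_eqI[of _ _ "(v + shift) - real_vec z"]) auto
  qed
  then show ?thesis by (simp add: R_translate_diff)
qed

lemma in_cell_0: "v \<in> D \<longleftrightarrow> R (v + shift) = 0"
  using in_cell[of v 0] by simp

text \<open>By equivariance a jump of \<open>R\<close> at \<open>u\<close> puts \<open>u\<close> on
  an integer translate of the boundary of the zero cell; there are countably many such null
  sets.\<close>

lemma ae_locally_constant_R: "ae_locally_constant R"
proof -
  let ?C = "R -` {0}"
  have "negligible (frontier ?C)"
    using quantizer by (simp add: quantizer_def jordan_measurable_def negligible_iff_null_sets)
  then have "negligible (\<Union>z. (+) (real_vec z) ` frontier ?C)"
    by (intro negligible_UN_countable negligible_translation)
  moreover have "{u. \<not> (\<forall>\<^sub>F u' in nhds u. R u' = R u)} \<subseteq> (\<Union>z. (+) (real_vec z) ` frontier ?C)"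
  proof
    fix u assume u: "u \<in> {u. \<not> (\<forall>\<^sub>F u' in nhds u. R u' = R u)}"
    let ?v = "u - real_vec (R u)"
    have "R ?v = 0" by (simp add: R_translate_diff)
    have "?v \<notin> interior ?C"
    proof
      assume "?v \<in> interior ?C"
      then have "\<forall>\<^sub>F v in nhds ?v. R v = 0"
        by (auto simp: eventually_nhds interior_def)
      moreover have "((\<lambda>u'. u' - real_vec (R u)) \<longlongrightarrow> ?v) (nhds u)"
        by (intro tendsto_intros filterlim_ident)
      ultimately have "\<forall>\<^sub>F u' in nhds u. R (u' - real_vec (R u)) = 0"
        by (rule eventually_compose_filterlim)
      then have "\<forall>\<^sub>F u' in nhds u. R u' = R u"
        by (simp add: R_translate_diff)
      with u show False by simp
    qed
    moreover have "?v \<in> closure ?C" using \<open>R ?v = 0\<close> closure_subset[of ?C] by auto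
    ultimately have "?v \<in> frontier ?C" by (simp add: frontier_def)
    then show "u \<in> (\<Union>z. (+) (real_vec z) ` frontier ?C)"
      by (intro UN_I[of "R u"] image_eqI[of _ _ ?v]) auto
  qed
  ultimately show ?thesis
    unfolding ae_locally_constant_def by (rule negligible_subset)
qed

lemma bounded_cell: "bounded (R -` {0})"
  using quantizer by (simp add: quantizer_def jordan_measurable_def)

lemma fundamental_domain_D: "fundamental_domain D"
  unfolding fundamental_domain_def
proof (intro conjI allI)
  have D: "D = (+) (- shift) ` (R -` {0})"
    unfolding shifted_cell_def by (intro image_cong) auto
  have "R -` {0} \<in> sets lebesgue"
    using ae_locally_constant_level_set[OF ae_locally_constant_R, of 0] by (simp add: vimage_def)
  then show "D \<in> sets lebesgue" unfolding D by (rule lebesgue_sets_translation)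
  show "bounded D" unfolding D by (rule bounded_translation[OF bounded_cell])
  show "\<exists>!z. v - real_vec z \<in> D" for v by (auto simp: in_cell)
qed

text \<open>One finite window for all \<open>u\<close> in a bounded set. With the cell it yields
  finitely many successor states, with a ball it yields local constancy.\<close>

lemma finite_pre_window:
  assumes "bounded U" "finite A"
  shows "finite (\<Union>u\<in>U. pre u A)"
proof -
  let ?V = "\<Union>a\<in>A. (\<lambda>(u, v). u + v) ` (U \<times> (\<lambda>c. Linv *v (c + real_vec a)) ` (R -` {0}))"
  have "bounded ((\<lambda>c. Linv *v (c + real_vec a)) ` (R -` {0}))" for a
  proof -
    have "bounded ((*v) Linv ` (+) (real_vec a) ` (R -` {0}))"
      by (intro bounded_linear_image bounded_translation bounded_cell matrix_vector_mul_bounded_linear)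
    then show ?thesis by (simp add: image_image add.commute)
  qed
  then have "bounded ?V"
    using assms by (intro bounded_UN ballI bounded_plus) auto
  moreover have "(\<Union>u\<in>U. pre u A) \<subseteq> {z. real_vec z \<in> ?V}"
  proof clarify
    fix z u assume "u \<in> U" "z \<in> pre u A"
    define a where "a = R (L *v (real_vec z - u))"
    define c where "c = L *v (real_vec z - u) - real_vec a"
    have "a \<in> A" using \<open>z \<in> pre u A\<close> by (simp add: pre_def a_def)
    moreover have "R c = 0" by (simp add: c_def R_translate_diff a_def)
    moreover have "real_vec z = u + Linv *v (c + real_vec a)"
      by (simp add: c_def)
    ultimately show "real_vec z \<in> ?V" using \<open>u \<in> U\<close>
      by (intro UN_I[of a] image_eqI[of _ _ "(u, Linv *v (c + real_vec a))"]) auto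
  qed
  ultimately show ?thesis using finite_bounded_real_vec finite_subset by metis
qed

lemma finite_pre: "finite A \<Longrightarrow> finite (pre u A)"
  using finite_pre_window[of "{u}" A] by simp

lemma finite_range_pre: "finite A \<Longrightarrow> finite ((\<lambda>u. pre u A) ` D)"
proof -
  assume "finite A"
  then have "finite (Pow (\<Union>u\<in>D. pre u A))"
    using fundamental_domain_D by (simp add: finite_pre_window fundamental_domain_def)
  then show ?thesis by (rule rev_finite_subset) auto
qed

lemma pre_empty [simp]: "pre u {} = {}"
  by (simp add: pre_def)

text \<open>Membership of z depends on \<open>R\<close> at the point L(z - u). The bad
  \<open>u\<close> for one z form an affine image of the null set where \<open>R\<close> jumps, and
  there are countably many z.\<close>

lemma ae_locally_constant_pre:
  assumes "finite A"
  shows "ae_locally_constant (\<lambda>u. pre u A)"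
proof -
  let ?E = "{p. \<not> (\<forall>\<^sub>F p' in nhds p. R p' = R p)}"
  have "negligible ((\<lambda>p. real_vec z - Linv *v p) ` ?E)" for z
    using ae_locally_constant_R unfolding ae_locally_constant_def
    by (rule negligible_differentiable_image_negligible[OF order_refl])
      (intro differentiable_on_diff differentiable_on_const bounded_linear_imp_differentiable_on matrix_vector_mul_bounded_linear)
  then have "negligible (\<Union>z. (\<lambda>p. real_vec z - Linv *v p) ` ?E)"
    by (rule negligible_UN_countable)
  moreover have "{u. \<not> (\<forall>\<^sub>F u' in nhds u. pre u' A = pre u A)} \<subseteq> (\<Union>z. (\<lambda>p. real_vec z - Linv *v p) ` ?E)"
  proof (rule subsetI, rule ccontr)
    fix u assume u: "u \<in> {u. \<not> (\<forall>\<^sub>F u' in nhds u. pre u' A = pre u A)}"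
      and "u \<notin> (\<Union>z. (\<lambda>p. real_vec z - Linv *v p) ` ?E)"
    have good: "\<forall>\<^sub>F p' in nhds (L *v (real_vec z - u)). R p' = R (L *v (real_vec z - u))" for z
    proof (rule ccontr)
      assume "\<not> ?thesis"
      then have "L *v (real_vec z - u) \<in> ?E" by simp
      moreover have "u = real_vec z - Linv *v (L *v (real_vec z - u))" by simp
      ultimately have "u \<in> (\<lambda>p. real_vec z - Linv *v p) ` ?E" by blast
      with \<open>u \<notin> _\<close> show False by blast
    qed
    have near: "\<forall>\<^sub>F u' in nhds u. R (L *v (real_vec z - u')) = R (L *v (real_vec z - u))" for z
    proof (rule eventually_compose_filterlim[OF good])
      show "((\<lambda>u'. L *v (real_vec z - u')) \<longlongrightarrow> L *v (real_vec z - u)) (nhds u)"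
        by (intro bounded_linear.tendsto[OF matrix_vector_mul_bounded_linear] tendsto_intros filterlim_ident)
    qed
    \<comment> \<open>For all u' in this ball, lattice points outside the window belong to no
      \<open>pre u' A\<close>; so finitely many neighbourhoods have to be intersected.\<close>
    let ?K = "\<Union>u'\<in>ball u 1. pre u' A"
    have "finite ?K" using assms by (intro finite_pre_window) auto
    then have "\<forall>\<^sub>F u' in nhds u. \<forall>z\<in>?K. R (L *v (real_vec z - u')) = R (L *v (real_vec z - u))"
      using near by (intro eventually_ball_finite) auto
    moreover have "\<forall>\<^sub>F u' in nhds u. u' \<in> ball u 1"
      by (intro eventually_nhds_in_open) auto
    ultimately have "\<forall>\<^sub>F u' in nhds u. pre u' A = pre u A"
    proof eventually_elim
      case (elim u')
      have sub: "pre u' A \<subseteq> ?K" "pre u A \<subseteq> ?K" using elim(2) by (force intro: centre_in_ball[THEN iffD2])+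
      have "z \<in> pre u' A \<longleftrightarrow> z \<in> pre u A" if "z \<in> ?K" for z
        using elim(1) that unfolding pre_def by (metis (mono_tags, lifting) mem_Collect_eq)
      with sub show ?case by blast
    qed
    with u show False by simp
  qed
  ultimately show ?thesis unfolding ae_locally_constant_def by (rule negligible_subset)
qed

lemma sets_pre [measurable]: "finite A \<Longrightarrow> {u. pre u A = B} \<in> sets lebesgue"
  using ae_locally_constant_level_set[OF ae_locally_constant_pre] .

section \<open>The kernel and the recurrence as finite sums\<close>

lemma transition_kernel_eq: "transition_kernel R L B A = measure lebesgue (D \<inter> {u. pre u A = B})"
proof -
  have "real_vec -` ((\<lambda>v. u + Linv *v v) ` (real_vec ` A + R -` {0})) = pre u A" for u
  proof (intro set_eqI iffI)
    fix z assume "z \<in> real_vec -` ((\<lambda>v. u + Linv *v v) ` (real_vec ` A + R -` {0}))"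
    then obtain a c where "a \<in> A" "R c = 0" and z: "real_vec z = u + Linv *v (real_vec a + c)"
      by (auto elim!: set_plus_elim)
    have "L *v (real_vec z - u) = c + real_vec a" by (simp add: z add.commute)
    then show "z \<in> pre u A" using \<open>a \<in> A\<close> \<open>R c = 0\<close> by (simp add: pre_def R_translate)
  next
    fix z assume z: "z \<in> pre u A"
    define a where "a = R (L *v (real_vec z - u))"
    define c where "c = L *v (real_vec z - u) - real_vec a"
    have "a \<in> A" using z by (simp add: pre_def a_def)
    moreover have "R c = 0" by (simp add: c_def R_translate_diff a_def)
    ultimately have "real_vec a + c \<in> real_vec ` A + R -` {0}" by (intro set_plus_intro) auto
    moreover have "real_vec z = u + Linv *v (real_vec a + c)"
      by (simp add: c_def)
    ultimately show "z \<in> real_vec -` ((\<lambda>v. u + Linv *v v) ` (real_vec ` A + R -` {0}))"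
      by blast
  qed
  then show ?thesis by (simp add: transition_kernel_def Collect_conj_eq)
qed

lemma transition_kernel_nonneg: "0 \<le> transition_kernel R L B A"
  by (simp add: transition_kernel_def)

lemma transition_kernel_eq_0: "B \<notin> (\<lambda>u. pre u A) ` D \<Longrightarrow> transition_kernel R L B A = 0"
proof -
  assume "B \<notin> (\<lambda>u. pre u A) ` D"
  then have "D \<inter> {u. pre u A = B} = {}" by auto
  then show ?thesis by (simp add: transition_kernel_eq)
qed

text \<open>The events are disjoint parts of a cell of measure 1. On nonempty sets the kernel may be
  strictly substochastic, the missing mass being that of the transition to the empty set.\<close>

lemma sum_transition_kernel_le_1:
  assumes "finite A" "finite G"
  shows "(\<Sum>B\<in>G. transition_kernel R L B A) \<le> 1"
proof -
  have D: "D \<in> sets lebesgue" "D \<in> lmeasurable"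
    using fundamental_domain_D bounded_set_imp_lmeasurable by (auto simp: fundamental_domain_def)
  have meas: "D \<inter> {u. pre u A = B} \<in> lmeasurable" for B
    using fmeasurable_Int_fmeasurable[OF D(2) sets_pre[OF assms(1)]] .
  have "(\<Sum>B\<in>G. transition_kernel R L B A) = measure lebesgue (\<Union>B\<in>G. D \<inter> {u. pre u A = B})"
    unfolding transition_kernel_eq using meas assms(2)
    by (intro measure_UNION'[symmetric]) (auto simp: pairwise_def disjnt_def)
  also have "\<dots> \<le> measure lebesgue D"
    using D assms by (intro measure_mono_fmeasurable) (auto intro!: sets.finite_UN)
  also have "\<dots> = 1" using measure_fundamental_domain[OF fundamental_domain_D] .
  finally show ?thesis .
qed

text \<open>The kernel has finite support in \<open>B\<close>. The family \<open>G\<close> is left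
  free so that it can be the successors of a single state, all nonempty states of one time, or empty
  when \<open>A\<close> is empty.\<close>

lemma H_rec_has_sum:
  assumes G: "finite G" "G \<subseteq> finite_lattice_sets" "\<And>u. u \<in> D \<Longrightarrow> pre u A \<noteq> {} \<Longrightarrow> pre u A \<in> G"
  shows "((\<lambda>B. transition_kernel R L B A * H_rec R L N B)
      has_sum (\<Sum>B\<in>G. transition_kernel R L B A * H_rec R L N B)) finite_lattice_sets"
proof -
  have "transition_kernel R L B A = 0" if "B \<in> finite_lattice_sets - G" for B
    using that G(3) by (intro transition_kernel_eq_0) (auto simp: finite_lattice_sets_def)
  then show ?thesis
    using has_sum_finite[OF G(1)] G(2) by (subst has_sum_cong_neutral[where T = G]) auto
qed

lemma H_rec_Suc:
  assumes "finite G" "G \<subseteq> finite_lattice_sets" "\<And>u. u \<in> D \<Longrightarrow> pre u A \<noteq> {} \<Longrightarrow> pre u A \<in> G"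
  shows "H_rec R L (Suc N) A = (\<Sum>B\<in>G. transition_kernel R L B A * H_rec R L N B)"
  using infsumI[OF H_rec_has_sum[OF assms]] by simp

lemma finite_successors:
  assumes "finite A"
  shows "finite ((\<lambda>u. pre u A) ` D - {{}})" "(\<lambda>u. pre u A) ` D - {{}} \<subseteq> finite_lattice_sets"
  using finite_range_pre[OF assms] finite_pre[OF assms] by (auto simp: finite_lattice_sets_def)

lemma H_rec_bounds: "A \<in> finite_lattice_sets \<Longrightarrow> 0 \<le> H_rec R L N A \<and> H_rec R L N A \<le> 1"
proof (induction N arbitrary: A)
  case (Suc N)
  let ?G = "(\<lambda>u. pre u A) ` D - {{}}"
  have A: "finite A" using Suc.prems by (simp add: finite_lattice_sets_def)
  note G = finite_successors[OF A]
  have eq: "H_rec R L (Suc N) A = (\<Sum>B\<in>?G. transition_kernel R L B A * H_rec R L N B)"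
    using G by (intro H_rec_Suc) auto
  have "0 \<le> (\<Sum>B\<in>?G. transition_kernel R L B A * H_rec R L N B)"
    using Suc.IH G by (intro sum_nonneg mult_nonneg_nonneg transition_kernel_nonneg) blast
  moreover have "(\<Sum>B\<in>?G. transition_kernel R L B A * H_rec R L N B) \<le> (\<Sum>B\<in>?G. transition_kernel R L B A)"
    using Suc.IH G by (intro sum_mono mult_right_le_one_le transition_kernel_nonneg) blast+
  ultimately show ?case using sum_transition_kernel_le_1[OF A G(1)] unfolding eq by linarith
qed simp

text \<open>\<open>rep v\<close> is the representative of \<open>v\<close> in the cell modulo the
  lattice. Applied to L^-1 \<open>x\<^sub>k\<close> it is the residual
  \<open>u\<^sub>k\<^sub>+\<^sub>1\<close>, and \<open>w\<close> is the factor by which the weight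
  changes in the transition to \<open>B\<close>.\<close>

lemma trig_approximable_transition:
  fixes \<xi> :: "real ^ 'n" and B :: "(int ^ 'n) set"
  assumes "finite A"
  defines "rep \<equiv> \<lambda>v. v - real_vec (R (v + shift))"
  defines "w \<equiv> \<lambda>v. of_bool (pre (rep v) A = B) * character \<xi> (rep v)"
  shows "trig_approximable D w" "set_integrable lebesgue D w"
    and "\<xi> = 0 \<Longrightarrow> (LINT v:D|lebesgue. w v) = of_real (transition_kernel R L B A)"
proof -
  have bound: "norm (w v) \<le> 1" for v by (simp add: w_def norm_mult)
  show "trig_approximable D w"
  proof (rule trig_approximable_complex[OF fundamental_domain_D bound])
    have rep: "rep (v + real_vec z) = rep v" for v z
    proof -
      have "R (v + real_vec z + shift) = R (v + shift) + z"
        using R_translate[of "v + shift" z] by (simp add: ac_simps)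
      then show ?thesis by (simp add: rep_def real_vec_add)
    qed
    show "w (v + real_vec z) = w v" for v z by (simp add: w_def rep)
    let ?E = "{p. \<not> (\<forall>\<^sub>F p' in nhds p. R p' = R p)}"
    let ?F = "{u. \<not> (\<forall>\<^sub>F u' in nhds u. pre u' A = pre u A)}"
    \<comment> \<open>\<open>w\<close> can be discontinuous only where the integer part of
      \<open>v\<close> jumps, which is the first set, or where \<open>pre\<close> jumps at the
      representative, which is the second.\<close>
    have "negligible ((+) (- shift) ` ?E \<union> (\<Union>z. (+) (real_vec z) ` ?F))"
      using ae_locally_constant_R ae_locally_constant_pre[OF assms(1)] unfolding ae_locally_constant_def
      by (intro negligible_Un negligible_UN_countable negligible_translation)
    moreover have "{v. \<not> isCont w v} \<subseteq> (+) (- shift) ` ?E \<union> (\<Union>z. (+) (real_vec z) ` ?F)"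
    proof (rule subsetI, rule ccontr)
      fix v assume v: "v \<in> {v. \<not> isCont w v}"
        and nin: "v \<notin> (+) (- shift) ` ?E \<union> (\<Union>z. (+) (real_vec z) ` ?F)"
      define z where "z = R (v + shift)"
      have "v + shift \<notin> ?E"
      proof
        assume E: "v + shift \<in> ?E"
        have "v = - shift + (v + shift)" by simp
        then have "v \<in> (+) (- shift) ` ?E" using E by (rule image_eqI)
        with nin show False by blast
      qed
      then have "\<forall>\<^sub>F p' in nhds (v + shift). R p' = z" by (simp add: z_def)
      moreover have "((\<lambda>v'. v' + shift) \<longlongrightarrow> v + shift) (nhds v)"
        by (intro tendsto_intros filterlim_ident)
      ultimately have 1: "\<forall>\<^sub>F v' in nhds v. R (v' + shift) = z"
        by (rule eventually_compose_filterlim)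
      have "v - real_vec z \<notin> ?F"
      proof
        assume "v - real_vec z \<in> ?F"
        moreover have "v = real_vec z + (v - real_vec z)" by simp
        ultimately have "v \<in> (+) (real_vec z) ` ?F" by (rule image_eqI[rotated])
        with nin show False by blast
      qed
      then have "\<forall>\<^sub>F u in nhds (v - real_vec z). pre u A = pre (v - real_vec z) A" by simp
      moreover have "((\<lambda>v'. v' - real_vec z) \<longlongrightarrow> v - real_vec z) (nhds v)"
        by (intro tendsto_intros filterlim_ident)
      ultimately have 2: "\<forall>\<^sub>F v' in nhds v. pre (v' - real_vec z) A = pre (v - real_vec z) A"
        by (rule eventually_compose_filterlim)
      let ?g = "\<lambda>v'. of_bool (pre (v - real_vec z) A = B) * character \<xi> (v' - real_vec z)"
      from 1 2 have "\<forall>\<^sub>F v' in nhds v. w v' = ?g v'"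
        by eventually_elim (simp add: w_def rep_def)
      moreover have "continuous_on UNIV ?g"
        by (intro continuous_intros continuous_on_compose2[OF continuous_on_character[of UNIV]]) auto
      then have "isCont ?g v" by (simp add: continuous_on_eq_continuous_at)
      ultimately have "isCont w v" using isCont_cong[of w ?g v] by blast
      with v show False by simp
    qed
    ultimately show "negligible {v. \<not> isCont w v}" by (rule negligible_subset)
  qed
  have D: "D \<in> sets lebesgue" "bounded D" using fundamental_domain_D by (auto simp: fundamental_domain_def)
  have S: "{u. pre u A = B} \<in> sets lebesgue" using assms(1) by (rule sets_pre)
  have w: "w v = of_bool (pre v A = B) * character \<xi> v" if "v \<in> D" for v
    using that by (simp add: w_def rep_def in_cell_0)
  have ind: "(of_bool (pre v A = B) :: complex) = indicator {u. pre u A = B} v" for v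
    by (simp add: indicator_def)
  have "set_integrable lebesgue D (\<lambda>v. of_bool (pre v A = B) * character \<xi> v)"
  proof (rule integrable_indicator_bounded[OF D])
    show "(\<lambda>v. of_bool (pre v A = B) * character \<xi> v) \<in> borel_measurable lebesgue"
      unfolding ind using S by (intro borel_measurable_times measurable_character borel_measurable_indicator)
    show "norm (of_bool (pre v A = B) * character \<xi> v) \<le> 1" for v
      by (simp add: norm_mult)
  qed
  then show "set_integrable lebesgue D w"
    using w by (subst set_integrable_cong[OF refl refl]) auto
  assume "\<xi> = 0"
  have "(LINT v:D|lebesgue. w v) = (LINT v|lebesgue. complex_of_real (indicator (D \<inter> {u. pre u A = B}) v))"
    unfolding set_lebesgue_integral_def
    by (intro Bochner_Integration.integral_cong) (auto simp: w \<open>\<xi> = 0\<close> indicator_def)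
  also have "\<dots> = of_real (measure lebesgue (D \<inter> {u. pre u A = B}))"
    using D S by (simp add: Int_commute)
  finally show "(LINT v:D|lebesgue. w v) = of_real (transition_kernel R L B A)"
    by (simp add: transition_kernel_eq)
qed

section \<open>Backward orbits, the chain of states, and its forward distribution\<close>

primrec orbit :: "nat \<Rightarrow> int ^ 'n \<Rightarrow> int ^ 'n" where
  "orbit 0 y = y"
| "orbit (Suc k) y = R (Linv *v real_vec (orbit k y) + shift)"

definition state :: "nat \<Rightarrow> int ^ 'n \<Rightarrow> (int ^ 'n) set" where
  "state k y = {z. (quantized_map R L ^^ k) (z + orbit k y) = y}"

text \<open>A finite set that contains every state at time \<open>k\<close>, whatever
  \<open>y\<close> is. It may contain the empty set, the absorbing state of those \<open>y\<close>
  that are not reachable in \<open>k\<close> steps.\<close>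

primrec states :: "nat \<Rightarrow> (int ^ 'n) set set" where
  "states 0 = {{0}}"
| "states (Suc k) = (\<Union>A\<in>states k. (\<lambda>u. pre u A) ` D)"

primrec prob :: "nat \<Rightarrow> (int ^ 'n) set \<Rightarrow> real" where
  "prob 0 B = of_bool (B = {0})"
| "prob (Suc k) B = (\<Sum>A\<in>states k. prob k A * transition_kernel R L B A)"

lemma residual_in_cell: "Linv *v real_vec (orbit k y) - real_vec (orbit (Suc k) y) \<in> D"
  by (simp add: in_cell)

lemma state_0: "state 0 y = {0}"
  by (auto simp: state_def)

lemma state_Suc:
  "state (Suc k) y = pre (Linv *v real_vec (orbit k y) - real_vec (orbit (Suc k) y)) (state k y)"
proof -
  let ?u = "Linv *v real_vec (orbit k y) - real_vec (orbit (Suc k) y)"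
  \<comment> \<open>L maps z + \<open>x\<^sub>k\<^sub>+\<^sub>1\<close> to L(z - u) +
    \<open>x\<^sub>k\<close>, and \<open>R\<close> lets the integer vector pass. Thus the innermost
    application of the map turns membership at time k+1 into membership at time k.\<close>
  have "quantized_map R L (z + orbit (Suc k) y) = R (L *v (real_vec z - ?u)) + orbit k y" for z
  proof -
    have "L *v (real_vec z - ?u) = L *v real_vec (z + orbit (Suc k) y) - real_vec (orbit k y)"
      by (simp add: real_vec_add matrix_vector_mult_diff_distrib matrix_vector_right_distrib del: orbit.simps)
    then show ?thesis by (simp add: quantized_map_def R_translate_diff del: orbit.simps)
  qed
  then show ?thesis
    unfolding state_def pre_def funpow_Suc_right o_apply by simp
qed

lemma states_finite: "finite (states k)" "A \<in> states k \<Longrightarrow> finite A"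
proof -
  have "finite (states k) \<and> (\<forall>A\<in>states k. finite A)"
  proof (induction k)
    case (Suc k)
    then show ?case by (auto intro!: finite_UN_I finite_range_pre finite_pre)
  qed simp
  then show "finite (states k)" "A \<in> states k \<Longrightarrow> finite A" by auto
qed

lemma state_in_states: "state k y \<in> states k"
proof (induction k)
  case (Suc k)
  have "state (Suc k) y \<in> (\<lambda>u. pre u (state k y)) ` D"
    unfolding state_Suc using residual_in_cell by blast
  with Suc show ?case by auto
qed (simp add: state_0)

lemma prob_recurrence:
  "(\<Sum>B\<in>states (Suc k) - {{}}. prob (Suc k) B * H_rec R L N B)
    = (\<Sum>A\<in>states k - {{}}. prob k A * H_rec R L (Suc N) A)"
proof -
  let ?G = "states (Suc k) - {{}}"
  have G: "finite ?G" "?G \<subseteq> finite_lattice_sets"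
    using states_finite(1)[of "Suc k"] states_finite(2)[where k = "Suc k"] by (auto simp: finite_lattice_sets_def simp del: states.simps)
  have "(\<Sum>B\<in>?G. prob (Suc k) B * H_rec R L N B)
      = (\<Sum>A\<in>states k. prob k A * (\<Sum>B\<in>?G. transition_kernel R L B A * H_rec R L N B))"
    by (simp only: prob.simps sum_distrib_right sum_distrib_left mult.assoc) (rule sum.swap)
  also have "\<dots> = (\<Sum>A\<in>states k. prob k A * H_rec R L (Suc N) A)"
    using G by (intro sum.cong refl arg_cong2[where f = "(*)"] H_rec_Suc[symmetric]) auto
  also have "\<dots> = (\<Sum>A\<in>states k - {{}}. prob k A * H_rec R L (Suc N) A)"
  proof (rule sum.mono_neutral_right)
    \<comment> \<open>At the empty set \<open>H_rec\<close> vanishes from time 1 on, but it is 1 at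
      time 0; hence the empty state is removed from the sums explicitly.\<close>
    have "H_rec R L (Suc N) {} = (\<Sum>B\<in>{}. transition_kernel R L B {} * H_rec R L N B)"
      by (rule H_rec_Suc) auto
    then show "\<forall>A\<in>states k - (states k - {{}}). prob k A * H_rec R L (Suc N) A = 0" by auto
  qed (use states_finite in auto)
  finally show ?thesis .
qed

text \<open>Duality of the forward and the backward equation: pairing \<open>prob\<close> at time k
  with \<open>H_rec\<close> at time j depends on j + k only. One end of the scale is the probability
  of a nonempty state at time N, the other is the recurrence evaluated at {0}.\<close>

lemma sum_prob_eq_H_rec: "(\<Sum>B\<in>states N - {{}}. prob N B) = H_rec R L N {0}"
proof -
  have "(\<Sum>B\<in>states k - {{}}. prob k B * H_rec R L j B) = H_rec R L (j + k) {0}" for j k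
  proof (induction k arbitrary: j)
    case 0
    have "states 0 - {{}} = {{0}}" by auto
    then show ?case by simp
  next
    case (Suc k)
    have "(\<Sum>B\<in>states (Suc k) - {{}}. prob (Suc k) B * H_rec R L j B) = H_rec R L (Suc j + k) {0}"
      unfolding prob_recurrence by (rule Suc.IH)
    then show ?case by simp
  qed
  from this[of N 0] show ?thesis by simp
qed

text \<open>Generated by \<xi> \<mapsto> (\<xi> + c) L^-1, the way frequencies change when time goes
  back by one step and an integer mode c is picked up. It starts from \<xi> = 0 with a nonzero mode,
  so 0 itself is not put in.\<close>

inductive_set frequencies :: "(real ^ 'n) set" where
  base: "c \<noteq> 0 \<Longrightarrow> real_vec c v* Linv \<in> frequencies"
| step: "\<xi> \<in> frequencies \<Longrightarrow> (\<xi> + real_vec c) v* Linv \<in> frequencies"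

lemma vector_matrix_mult_rows: "x v* (A :: real^'n^'n) = (\<Sum>i\<in>UNIV. x $ i *\<^sub>R row i A)"
  by (simp add: vec_eq_iff vector_matrix_mult_def row_def mult.commute)

lemma matrix_powi_neg: "matrix_powi L (- int (Suc j)) = (((**) Linv) ^^ Suc j) (mat 1)"
proof -
  have "\<not> 0 \<le> - int (Suc j)" "nat (- (- int (Suc j))) = Suc j"
    by (simp_all only: minus_minus nat_int)
  then show ?thesis by (simp only: matrix_powi_def if_False)
qed

lemma funpow_matrix_mult_right: "(((**) (A :: real^'n^'n)) ^^ j) (mat 1) ** A = (((**) A) ^^ Suc j) (mat 1)"
  by (induction j) (simp_all flip: matrix_mul_assoc)

lemma frequencies_expansion:
  "\<xi> \<in> frequencies \<Longrightarrow> \<exists>m c. (\<exists>j<m. c j \<noteq> 0) \<and>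
     \<xi> = (\<Sum>j<m. real_vec (c j) v* matrix_powi L (- int (Suc j)))"
proof (induction rule: frequencies.induct)
  case (base c)
  have "real_vec c v* Linv = (\<Sum>j<1. real_vec c v* matrix_powi L (- int (Suc j)))"
    unfolding matrix_powi_neg by simp
  then show ?case using base by (intro exI[of _ 1] exI[of _ "\<lambda>_. c"]) auto
next
  case (step \<xi> d)
  then obtain m c where c: "\<exists>j<m. c j \<noteq> 0" and \<xi>: "\<xi> = (\<Sum>j<m. real_vec (c j) v* matrix_powi L (- int (Suc j)))"
    by blast
  \<comment> \<open>The new vector goes with L^-1, and every old one moves to the next negative
    power; index j stands for the power -(j+1).\<close>
  define c' where "c' j = (case j of 0 \<Rightarrow> d | Suc i \<Rightarrow> c i)" for j
  have shift: "matrix_powi L (- int (Suc j)) ** Linv = matrix_powi L (- int (Suc (Suc j)))" for j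
    unfolding matrix_powi_neg by (rule funpow_matrix_mult_right)
  have lin: "(\<Sum>j\<in>J. f j) v* Linv = (\<Sum>j\<in>J. f j v* Linv)" if "finite J" for f :: "nat \<Rightarrow> real^'n" and J
    using that by (induction J) (simp_all add: vector_matrix_left_distrib)
  have "(\<xi> + real_vec d) v* Linv
      = real_vec d v* Linv + (\<Sum>j<m. (real_vec (c j) v* matrix_powi L (- int (Suc j))) v* Linv)"
    unfolding \<xi> by (simp add: vector_matrix_left_distrib lin add.commute)
  also have "\<dots> = real_vec d v* matrix_powi L (- int (Suc 0))
      + (\<Sum>j<m. real_vec (c j) v* matrix_powi L (- int (Suc (Suc j))))"
    unfolding vector_matrix_mul_assoc shift by (simp only: matrix_powi_neg) simp
  also have "\<dots> = (\<Sum>j<Suc m. real_vec (c' j) v* matrix_powi L (- int (Suc j)))"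
    unfolding sum.lessThan_Suc_shift by (simp add: c'_def)
  finally have "(\<xi> + real_vec d) v* Linv = (\<Sum>j<Suc m. real_vec (c' j) v* matrix_powi L (- int (Suc j)))" .
  moreover have "\<exists>j<Suc m. c' j \<noteq> 0" using c by (metis Suc_less_eq c'_def nat.simps(5))
  ultimately show ?case by blast
qed

text \<open>An integer value \<open>d\<close> of such a combination would be a rational relation
  between the rows of the identity and those of finitely many negative powers of \<open>L\<close>,
  with some nonzero coefficient.\<close>

lemma frequencies_not_integer:
  assumes "iteratively_nonresonant L" "\<xi> \<in> frequencies"
  shows "\<xi> \<notin> range real_vec"
proof
  assume "\<xi> \<in> range real_vec"
  then obtain d where d: "\<xi> = real_vec d" by blast
  obtain m c where c: "\<exists>j<m. c j \<noteq> 0" and \<xi>: "\<xi> = (\<Sum>j<m. real_vec (c j) v* matrix_powi L (- int (Suc j)))"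
    using frequencies_expansion[OF assms(2)] by blast
  let ?k = "\<lambda>j. - int (Suc j)"
  let ?I = "?k ` {..<m} \<times> (UNIV :: 'n set)"
  let ?r = "case_sum (\<lambda>i. row i (mat 1)) (\<lambda>(k, i). row i (matrix_powi L k))"
  \<comment> \<open>The coefficients of that relation: -\<open>d\<close> on the identity,
    \<open>c j\<close> on the power -(j+1). The expression \<open>nat (- k) - 1\<close> recovers j
    from the power.\<close>
  define a :: "'n + int \<times> 'n \<Rightarrow> rat" where
    "a = case_sum (\<lambda>i. - of_int (d $ i)) (\<lambda>(k, i). of_int (c (nat (- k) - 1) $ i))"
  have "finite ?I \<and> ?I \<subseteq> (UNIV - {0}) \<times> UNIV" by auto
  then have "nonresonant ?I (\<lambda>(k, i). row i (matrix_powi L k))"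
    using assms(1) unfolding iteratively_nonresonant_def by blast
  then have ind: "(\<Sum>j\<in>UNIV <+> ?I. of_rat (a j) *\<^sub>R ?r j) = 0 \<longrightarrow> (\<forall>j\<in>UNIV <+> ?I. a j = 0)"
    unfolding nonresonant_def rationally_independent_rows_def by (rule spec)
  have idx: "nat (int j + 1) - Suc 0 = j" for j
    by (simp add: nat_add_distrib)
  have inj: "inj_on ?k {..<m}" by (auto intro: inj_onI)
  have "(\<Sum>j\<in>UNIV <+> ?I. of_rat (a j) *\<^sub>R ?r j)
      = (\<Sum>i\<in>UNIV. of_rat (a (Inl i)) *\<^sub>R ?r (Inl i)) + (\<Sum>j\<in>?I. of_rat (a (Inr j)) *\<^sub>R ?r (Inr j))"
    by (rule sum.Plus[unfolded o_def, where g = "\<lambda>j. of_rat (a j) *\<^sub>R ?r j"])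
      (intro finite finite_SigmaI finite_imageI finite_lessThan)+
  also have "(\<Sum>i\<in>UNIV. of_rat (a (Inl i)) *\<^sub>R ?r (Inl i)) = - (real_vec d v* mat 1)"
    unfolding vector_matrix_mult_rows by (simp add: a_def real_vec_def of_rat_minus sum_negf)
  also have "(\<Sum>j\<in>?I. of_rat (a (Inr j)) *\<^sub>R ?r (Inr j))
      = (\<Sum>k\<in>?k ` {..<m}. \<Sum>i\<in>UNIV. of_rat (a (Inr (k, i))) *\<^sub>R row i (matrix_powi L k))"
    by (subst sum.cartesian_product) (simp add: case_prod_unfold)
  also have "\<dots> = (\<Sum>j<m. \<Sum>i\<in>UNIV. of_rat (a (Inr (?k j, i))) *\<^sub>R row i (matrix_powi L (?k j)))"
    by (subst sum.reindex[OF inj]) simp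
  also have "\<dots> = (\<Sum>j<m. real_vec (c j) v* matrix_powi L (?k j))"
    unfolding vector_matrix_mult_rows by (simp add: a_def real_vec_def idx)
  finally have "(\<Sum>j\<in>UNIV <+> ?I. of_rat (a j) *\<^sub>R ?r j) = 0"
    using d \<xi> by simp
  with ind have zero: "\<forall>j\<in>UNIV <+> ?I. a j = 0" by (rule mp)
  obtain j where "j < m" "c j \<noteq> 0" using c by blast
  then obtain i where "c j $ i \<noteq> 0" by (auto simp: vec_eq_iff)
  moreover have "a (Inr (?k j, i)) = 0"
    using \<open>j < m\<close> by (intro bspec[OF zero] InrI SigmaI imageI) simp_all
  ultimately show False by (simp add: a_def idx)
qed

text \<open>The case \<xi> = 0 is the one wanted; the vanishing of the other means is what makes the
  next residual behave as if it were uniform on the cell and independent of the current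
  state.\<close>

lemma state_equidistribution:
  assumes nonres: "iteratively_nonresonant L" and "\<xi> \<in> insert 0 frequencies"
  shows "has_box_mean (\<lambda>y. of_bool (state k y = B) * character \<xi> (real_vec (orbit k y)))
    (if \<xi> = 0 then of_real (prob k B) else 0)"
  using assms(2)
proof (induction k arbitrary: B \<xi>)
  case 0
  show ?case
  proof (cases "\<xi> = 0")
    case True
    have "has_box_mean (\<lambda>y :: int ^ 'n. of_bool ({0} = B) :: complex) (of_bool ({0} = B))"
      by (rule has_box_mean_const)
    then show ?thesis using True by (cases "B = {0}") (auto simp: state_0)
  next
    case False
    with 0 have "has_box_mean (\<lambda>y. character \<xi> (real_vec y)) 0"
      using frequencies_not_integer[OF nonres] by (intro has_box_mean_character) auto
    from has_box_mean_mult_left[OF this, of "of_bool ({0} = B)"] False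
    show ?thesis by (simp add: state_0)
  qed
next
  case (Suc k)
  define rep where "rep v = v - real_vec (R (v + shift))" for v
  define w where "w A v = of_bool (pre (rep v) A = B) * character (- \<xi>) (rep v)" for A v
  define v where "v y = Linv *v real_vec (orbit k y)" for y
  define a where "a A y = of_bool (state k y = A) * character \<xi> (v y)" for A y
  have zero: "0 \<notin> frequencies" using frequencies_not_integer[OF nonres, of 0] by (metis rangeI real_vec_0)
  \<comment> \<open>The induction hypothesis applies again after one step back, and the frequency
    becomes 0 only for the trivial mode; the latter uses that 0 is not in
    \<open>frequencies\<close>.\<close>
  have freq: "(\<eta> + real_vec c) v* Linv \<in> insert 0 frequencies"
    "(\<eta> + real_vec c) v* Linv = 0 \<longleftrightarrow> \<eta> = 0 \<and> c = 0" if "\<eta> \<in> insert 0 frequencies" for \<eta> c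
  proof -
    have *: "(\<eta> + real_vec c) v* Linv \<in> frequencies" if "\<not> (\<eta> = 0 \<and> c = 0)"
    proof (cases "\<eta> = 0")
      case True
      with that show ?thesis using frequencies.base[of c] by simp
    next
      case False
      then show ?thesis using \<open>\<eta> \<in> insert 0 frequencies\<close> by (intro frequencies.step) auto
    qed
    then show "(\<eta> + real_vec c) v* Linv \<in> insert 0 frequencies" by (cases "\<eta> = 0 \<and> c = 0") auto
    show "(\<eta> + real_vec c) v* Linv = 0 \<longleftrightarrow> \<eta> = 0 \<and> c = 0"
    proof (cases "\<eta> = 0 \<and> c = 0")
      case False
      with * have "(\<eta> + real_vec c) v* Linv \<noteq> 0" using zero by metis
      with False show ?thesis by blast
    qed simp
  qed
  \<comment> \<open>Used twice below: with \<eta> = \<xi> for the oscillating weight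
    \<open>a\<close>, and with \<eta> = 0 for the indicator that majorises it.\<close>
  have mean: "has_box_mean (\<lambda>y. (of_bool (state k y = A) * character \<eta> (v y)) * character (real_vec c) (v y))
      (if c = 0 then (if \<eta> = 0 then of_real (prob k A) else 0) else 0)"
    if "\<eta> \<in> insert 0 frequencies" for \<eta> A c
  proof -
    have "(of_bool (state k y = A) * character \<eta> (v y)) * character (real_vec c) (v y)
        = of_bool (state k y = A) * character ((\<eta> + real_vec c) v* Linv) (real_vec (orbit k y))" for y
      by (simp add: v_def character_add_left flip: character_matrix_vector)
    moreover have "(if (\<eta> + real_vec c) v* Linv = 0 then complex_of_real (prob k A) else 0)
        = (if c = 0 then (if \<eta> = 0 then of_real (prob k A) else 0) else 0)"
      unfolding freq(2)[OF that] by simp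
    ultimately show ?thesis using Suc.IH[OF freq(1)[OF that, of c], of A] by (simp only:)
  qed
  have term_mean: "has_box_mean (\<lambda>y. a A y * w A (v y))
      (if \<xi> = 0 then of_real (prob k A * transition_kernel R L B A) else 0)" if "A \<in> states k" for A
  proof -
    have A: "finite A" using that states_finite by blast
    have "has_box_mean (\<lambda>y. a A y * w A (v y))
        ((if \<xi> = 0 then of_real (prob k A) else 0) * (LINT v:D|lebesgue. w A v))"
    proof (rule has_box_mean_approximable[OF fundamental_domain_D])
      show "norm (a A y) \<le> of_bool (state k y = A)" for y by (simp add: a_def norm_mult)
      show "has_box_mean (\<lambda>y. a A y * character (real_vec c) (v y))
          (if c = 0 then if \<xi> = 0 then of_real (prob k A) else 0 else 0)" for c
        unfolding a_def by (rule mean[OF Suc.prems])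
      show "has_box_mean (\<lambda>y. complex_of_real (of_bool (state k y = A)) * character (real_vec c) (v y))
          (if c = 0 then of_real (prob k A) else 0)" for c
      proof -
        have "complex_of_real (of_bool P) = of_bool P" for P by (cases P) simp_all
        then show ?thesis
          using mean[OF insertI1, of A c] by (simp only: character_0 mult_1_right refl if_True)
      qed
      show "trig_approximable D (w A)" "set_integrable lebesgue D (w A)"
        unfolding w_def rep_def using trig_approximable_transition(1,2)[OF A] .
    qed
    moreover have "\<xi> = 0 \<Longrightarrow> (LINT v:D|lebesgue. w A v) = of_real (transition_kernel R L B A)"
      unfolding w_def rep_def using trig_approximable_transition(3)[OF A, of "- \<xi>"] by simp
    ultimately show ?thesis by (cases "\<xi> = 0") simp_all
  qed
  \<comment> \<open>Split by the state at time k. The sign in \<open>w\<close> comes from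
    \<open>x\<^sub>k\<^sub>+\<^sub>1\<close> being \<open>v y\<close> minus its residual.\<close>
  have decomp: "of_bool (state (Suc k) y = B) * character \<xi> (real_vec (orbit (Suc k) y))
      = (\<Sum>A\<in>states k. a A y * w A (v y))" for y
  proof -
    have rep: "rep (v y) = v y - real_vec (orbit (Suc k) y)" by (simp add: rep_def v_def)
    have "character \<xi> (v y) * character (- \<xi>) (rep (v y)) = character \<xi> (real_vec (orbit (Suc k) y))"
    proof -
      have "character \<xi> (v y) = character \<xi> (rep (v y)) * character \<xi> (real_vec (orbit (Suc k) y))"
        unfolding character_add_right[symmetric] rep by simp
      moreover have "character \<xi> (rep (v y)) * character (- \<xi>) (rep (v y)) = 1"
        unfolding character_add_left[symmetric] by simp
      ultimately show ?thesis by (simp add: algebra_simps)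
    qed
    moreover have "state (Suc k) y = pre (rep (v y)) (state k y)"
      unfolding rep by (simp add: state_Suc v_def)
    ultimately have "a (state k y) y * w (state k y) (v y)
        = of_bool (state (Suc k) y = B) * character \<xi> (real_vec (orbit (Suc k) y))"
      by (simp add: a_def w_def)
    moreover have "(\<Sum>A\<in>states k. a A y * w A (v y)) = (\<Sum>A\<in>{state k y}. a A y * w A (v y))"
      using states_finite state_in_states by (intro sum.mono_neutral_right) (auto simp: a_def)
    ultimately show ?thesis by simp
  qed
  have "has_box_mean (\<lambda>y. \<Sum>A\<in>states k. a A y * w A (v y))
      (\<Sum>A\<in>states k. if \<xi> = 0 then of_real (prob k A * transition_kernel R L B A) else 0)"
    by (rule has_box_mean_sum[OF states_finite(1) term_mean])
  then show ?case
    unfolding decomp by (cases "\<xi> = 0") simp_all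
qed

text \<open>A point is reachable in N steps exactly if its state at time N is nonempty, so its
  indicator is the finite sum of the indicators of the nonempty states, each with known
  mean.\<close>

lemma reachable_has_box_mean:
  assumes "iteratively_nonresonant L"
  shows "has_box_mean (indicat_real (range (quantized_map R L ^^ N))) (H_rec R L N {0})"
proof -
  let ?S = "states N - {{}}"
  have "has_box_mean (\<lambda>y. \<Sum>B\<in>?S. of_bool (state N y = B) :: complex) (\<Sum>B\<in>?S. of_real (prob N B))"
    using state_equidistribution[OF assms, of 0 N] states_finite(1)[of N]
    by (intro has_box_mean_sum) auto
  moreover have "(\<Sum>B\<in>?S. of_bool (state N y = B) :: complex)
      = of_real (indicator (range (quantized_map R L ^^ N)) y)" for y
  proof -
    have "y \<in> range (quantized_map R L ^^ N) \<longleftrightarrow> state N y \<noteq> {}"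
    proof
      assume "y \<in> range (quantized_map R L ^^ N)"
      then obtain x where "y = (quantized_map R L ^^ N) x" by blast
      then have "x - orbit N y \<in> state N y" by (simp add: state_def)
      then show "state N y \<noteq> {}" by blast
    next
      assume "state N y \<noteq> {}"
      then obtain z where "(quantized_map R L ^^ N) (z + orbit N y) = y" by (auto simp: state_def)
      then show "y \<in> range (quantized_map R L ^^ N)" by (metis rangeI)
    qed
    moreover have "(\<Sum>B\<in>?S. of_bool (state N y = B) :: complex) = of_bool (state N y \<in> ?S)"
      using states_finite(1)[of N] by (simp add: of_bool_def)
    ultimately show ?thesis using state_in_states[of N y] by (simp add: indicator_def)
  qed
  ultimately have "has_box_mean (\<lambda>y. complex_of_real (indicator (range (quantized_map R L ^^ N)) y))
      (complex_of_real (H_rec R L N {0}))"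
    by (simp flip: sum_prob_eq_H_rec of_real_sum)
  then have "((\<lambda>B. Re (box_average (\<lambda>y. complex_of_real (indicator (range (quantized_map R L ^^ N)) y)) B))
      \<longlongrightarrow> Re (complex_of_real (H_rec R L N {0}))) boxes_filter"
    unfolding has_box_mean_def by (rule tendsto_Re)
  then show ?thesis
    by (simp add: has_box_mean_def box_average_def[abs_def])
qed

end

text \<open>\<open>frequency\<close> is the lower frequency, hence it is paired with measurability.
  The recurrence is asserted with \<open>has_sum\<close>, because an infinite sum that does not
  converge would take the default value 0 in \<open>H_rec\<close>.\<close>

theorem theorem15:
  fixes R :: "real ^ 'n \<Rightarrow> int ^ 'n" and L :: "real ^ 'n ^ 'n" and N :: nat
  assumes "quantizer R"
    and "invertible L"
    and "iteratively_nonresonant L"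
  shows "frequency_measurable (range (quantized_map R L ^^ N))
    \<and> frequency (range (quantized_map R L ^^ N)) = H_rec R L N {0}
    \<and> (\<forall>A\<in>finite_lattice_sets. 0 \<le> H_rec R L N A \<and> H_rec R L N A \<le> 1)
    \<and> (\<forall>A\<in>finite_lattice_sets.
          ((\<lambda>B. transition_kernel R L B A * H_rec R L N B) has_sum H_rec R L (Suc N) A) finite_lattice_sets)"
proof -
  interpret quantized_system R L using assms by unfold_locales
  have "((\<lambda>B. transition_kernel R L B A * H_rec R L N B) has_sum H_rec R L (Suc N) A) finite_lattice_sets"
    if "A \<in> finite_lattice_sets" for A
  proof -
    let ?G = "(\<lambda>u. pre u A) ` D - {{}}"
    have "finite A" using that by (simp add: finite_lattice_sets_def)
    note G = finite_successors[OF this]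
    have "H_rec R L (Suc N) A = (\<Sum>B\<in>?G. transition_kernel R L B A * H_rec R L N B)"
      using G by (intro H_rec_Suc) auto
    moreover have "((\<lambda>B. transition_kernel R L B A * H_rec R L N B)
        has_sum (\<Sum>B\<in>?G. transition_kernel R L B A * H_rec R L N B)) finite_lattice_sets"
      using G by (intro H_rec_has_sum) auto
    ultimately show ?thesis by simp
  qed
  then show ?thesis
    using frequency_eq_box_mean[OF reachable_has_box_mean[OF assms(3)]] H_rec_bounds by blast
qed

end
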